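(* Let $p(n)$ denote the number of partitions of $n$. For all integers $n>1$, \[ \frac{p(n-1)}{p(n)}\left(1+\frac{1}{n}\right) > \frac{p(n)}{p(n+1)}. \]
   Context: $p(n)$ is the partition function: the number of ways of writing $n$ as an unordered sum of positive integers. *)

theory Defs
  imports Complex_Main "HOL-Library.Multiset"
begin

definition partitions_of :: "nat \<Rightarrow> nat multiset set" where
  "partitions_of n = {M. (\<forall>x \<in># M. x > 0) \<and> sum_mset M = n}"

definition partition_number :: "nat \<Rightarrow> nat" where
  "partition_number n = card (partitions_of n)"

end

theory Submission
  imports Defs "HOL-Probability.Distributions" "HOL-Complex_Analysis.Complex_Analysis"
begin

text \<open>
  For \<open>n < 800\<close> the inequality is checked by computing \<open>p(n)\<close> with the pentagonal recurrence.

  For larger \<open>n\<close>, write \<open>\<Sum> p(k) z^k = exp (\<Sum> \<sigma>(N)/N z^N)\<close> and choose \<open>x = exp (-t)\<close> with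
  \<open>\<Sum> \<sigma>(N) x^N = n\<close>. Then \<open>p(n)\<close>, \<open>p(n + 1)\<close> and \<open>p(n - 1)\<close> are, up to factors that cancel in
  \<open>p(n - 1) p(n + 1) / p(n)\<^sup>2\<close>, the integrals over \<open>[-\<pi>, \<pi>]\<close> of \<open>H(\<theta>)\<close>, \<open>H(\<theta>) exp (-i\<theta>)\<close> and
  \<open>H(\<theta>) exp (i\<theta>)\<close>, where \<open>H\<close> is the generating function on the circle of radius \<open>x\<close> times
  \<open>exp (-in\<theta>)\<close>. Hence \<open>p(n)\<^sup>2 - p(n - 1) p(n + 1)\<close> is at most of order
  \<open>(\<integral> |H|) (\<integral> |H| (1 - cos \<theta>))\<close>. Since \<open>|H|\<close> is close to a Gaussian of variance of order \<open>t^3\<close>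
  and \<open>t\<close> is of order \<open>n^(-1/2)\<close>, this is \<open>O(n^(-3/2)) p(n)\<^sup>2\<close>, while an error below
  \<open>p(n)\<^sup>2 / (n + 1)\<close> suffices. So crude estimates of \<open>H\<close> are enough, and all of them follow from bounds
  on the moments \<open>\<Sum> N^j \<sigma>(N)/N x^N\<close> for \<open>j \<le> 3\<close>; no modular transformation is needed.
\<close>

unbundle no vec_syntax
unbundle fps_syntax

section \<open>Partitions and divisor sums\<close>

lemma finite_partitions_of: "finite (partitions_of n)"
proof (induction n rule: less_induct)
  case (less n)
  have "partitions_of n \<subseteq> insert {#} (\<Union>k\<in>{1..n}. add_mset k ` partitions_of (n - k))"
  proof
    fix M assume M_in: "M \<in> partitions_of n"
    show "M \<in> insert {#} (\<Union>k\<in>{1..n}. add_mset k ` partitions_of (n - k))"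
    proof (cases M)
      case (add k N)
      with M_in have "k \<in> {1..n}" "N \<in> partitions_of (n - k)"
        by (auto simp: partitions_of_def Suc_le_eq)
      with add show ?thesis by blast
    qed simp
  qed
  moreover have "finite (\<Union>k\<in>{1..n}. add_mset k ` partitions_of (n - k))"
    using less.IH by auto
  ultimately show ?case by (meson finite.insertI finite_subset)
qed

lemma partition_number_pos: "partition_number n > 0"
proof -
  have "replicate_mset n 1 \<in> partitions_of n"
    by (auto simp: partitions_of_def)
  then show ?thesis
    unfolding partition_number_def using finite_partitions_of card_gt_0_iff by blast
qed

lemma partitions_of_0: "partitions_of 0 = {{#}}"
proof -
  have "M = {#}" if "M \<in> partitions_of 0" for M
    using that by (cases M) (auto simp: partitions_of_def)
  then show ?thesis by (auto simp: partitions_of_def)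
qed

lemma card_partitions_count_ge:
  assumes "0 < d" "d * i \<le> n"
  shows "card {M \<in> partitions_of n. i \<le> count M d} = partition_number (n - d * i)"
proof -
  let ?R = "replicate_mset i d"
  have "{M \<in> partitions_of n. i \<le> count M d} = (+) ?R ` partitions_of (n - d * i)"
  proof (intro equalityI subsetI)
    fix M assume M_in: "M \<in> {M \<in> partitions_of n. i \<le> count M d}"
    then obtain N where "M = ?R + N"
      by (auto simp: count_le_replicate_mset_subset_eq mset_subset_eq_exists_conv)
    with M_in show "M \<in> (+) ?R ` partitions_of (n - d * i)"
      by (auto simp: partitions_of_def mult.commute)
  qed (use assms in \<open>auto simp: partitions_of_def mult.commute split: if_splits\<close>)
  then show ?thesis
    by (simp add: partition_number_def card_image)
qed

lemma sum_mset_eq_sum_count: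
  fixes M :: "nat multiset"
  assumes "finite A" "set_mset M \<subseteq> A"
  shows "sum_mset M = (\<Sum>d\<in>A. count M d * d)"
  using assms(2)
proof (induction M)
  case (add x M)
  have "(\<Sum>d\<in>A. count (add_mset x M) d * d) = (\<Sum>d\<in>A. count M d * d + (if d = x then x else 0))"
    by (intro sum.cong) auto
  with add assms(1) show ?case by (simp add: sum.distrib)
qed simp

lemma sum_divisors:
  fixes f :: "nat \<Rightarrow> nat \<Rightarrow> 'a :: comm_monoid_add"
  shows "(\<Sum>k=1..n. \<Sum>d | d dvd k. f d (k div d)) = (\<Sum>d=1..n. \<Sum>i=1..n div d. f d i)"
proof -
  have "(\<Sum>k=1..n. \<Sum>d | d dvd k. f d (k div d))
      = (\<Sum>(k, d)\<in>Sigma {1..n} (\<lambda>k. {d. d dvd k}). f d (k div d))"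
    by (intro sum.Sigma) (auto intro: finite_divisors_nat)
  also have "\<dots> = (\<Sum>(d, i)\<in>Sigma {1..n} (\<lambda>d. {1..n div d}). f d i)"
  proof (rule sum.reindex_bij_witness[of _ "\<lambda>(d, i). (d * i, d)" "\<lambda>(k, d). (d, k div d)"])
    fix p assume "p \<in> Sigma {1..n} (\<lambda>k. {d. d dvd k})"
    then obtain k d where p_eq: "p = (k, d)" "0 < k" "k \<le> n" "d dvd k" by auto
    then have "0 < d" "d \<le> k" by (auto simp: dvd_imp_le intro!: Nat.gr0I)
    moreover from p_eq have "0 < k div d" "k div d \<le> n div d"
      by (auto simp: div_greater_zero_iff dvd_imp_le div_le_mono intro!: Nat.gr0I)
    ultimately show "(case p of (k, d) \<Rightarrow> (d, k div d)) \<in> Sigma {1..n} (\<lambda>d. {1..n div d})"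
      using p_eq by auto
  next
    fix q assume "q \<in> Sigma {1..n} (\<lambda>d. {1..n div d})"
    then obtain d i where q_eq: "q = (d, i)" "0 < d" "0 < i" "i \<le> n div d" by auto
    then have "d * i \<le> n"
      by (simp add: less_eq_div_iff_mult_less_eq mult.commute)
    with q_eq show "(case q of (d, i) \<Rightarrow> (d * i, d)) \<in> Sigma {1..n} (\<lambda>k. {d. d dvd k})" by auto
  qed auto
  also have "\<dots> = (\<Sum>d=1..n. \<Sum>i=1..n div d. f d i)"
    by (intro sum.Sigma[symmetric]) auto
  finally show ?thesis .
qed

definition divisor_sum :: "nat \<Rightarrow> nat" where
  "divisor_sum n = \<Sum>{d. d dvd n}"

text \<open>Both sides count, over all partitions of \<open>n\<close>, every part \<open>d\<close> as often as it occurs; the pair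
  \<open>(d, i)\<close> stands for the \<open>i\<close>-th occurrence of \<open>d\<close>.\<close>
lemma partition_number_divisor_sum:
  "n * partition_number n = (\<Sum>k=1..n. divisor_sum k * partition_number (n - k))"
proof -
  let ?P = "partitions_of n"
  have parts: "n = (\<Sum>d=1..n. \<Sum>i=1..n div d. if i \<le> count M d then d else 0)" if M_in: "M \<in> ?P" for M
  proof -
    have "set_mset M \<subseteq> {1..n}"
      using M_in by (auto simp: partitions_of_def Suc_le_eq dest!: multi_member_split)
    then have total_eq: "n = (\<Sum>d=1..n. count M d * d)"
      using M_in sum_mset_eq_sum_count[of "{1..n}" M] by (simp add: partitions_of_def)
    have "count M d * d = (\<Sum>i=1..n div d. if i \<le> count M d then d else 0)" if d_in: "d \<in> {1..n}" for d
    proof -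
      have "count M d * d \<le> n"
        by (subst total_eq) (use d_in in \<open>intro member_le_sum\<close>, auto)
      then have "count M d \<le> n div d"
        using d_in by (simp add: less_eq_div_iff_mult_less_eq)
      then have "{1..n div d} \<inter> {i. i \<le> count M d} = {1..count M d}" by auto
      then show ?thesis by (simp add: sum.If_cases)
    qed
    then show ?thesis using total_eq by (simp only: cong: sum.cong)
  qed
  have "n * partition_number n = (\<Sum>M\<in>?P. n)"
    by (simp add: partition_number_def)
  also have "\<dots> = (\<Sum>M\<in>?P. \<Sum>d=1..n. \<Sum>i=1..n div d. if i \<le> count M d then d else 0)"
    using parts by (rule sum.cong[OF refl])
  also have "\<dots> = (\<Sum>d=1..n. \<Sum>i=1..n div d. \<Sum>M\<in>?P. if i \<le> count M d then d else 0)"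
    by (simp only: sum.swap[of _ _ ?P])
  also have "\<dots> = (\<Sum>d=1..n. \<Sum>i=1..n div d. d * partition_number (n - d * i))"
    by (intro sum.cong refl)
       (simp add: finite_partitions_of sum.If_cases card_partitions_count_ge Collect_conj_eq[symmetric]
          less_eq_div_iff_mult_less_eq mult.commute Int_def)
  also have "\<dots> = (\<Sum>k=1..n. \<Sum>d | d dvd k. d * partition_number (n - d * (k div d)))"
    by (rule sum_divisors[symmetric])
  also have "\<dots> = (\<Sum>k=1..n. divisor_sum k * partition_number (n - k))"
    by (simp add: divisor_sum_def sum_distrib_right)
  finally show ?thesis .
qed

section \<open>The pentagonal recurrence\<close>

definition partition_fps :: "'a :: semiring_1 fps" where
  "partition_fps = Abs_fps (\<lambda>n. of_nat (partition_number n))"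

definition partitions_above :: "nat \<Rightarrow> nat \<Rightarrow> nat multiset set" where
  "partitions_above m n = {M \<in> partitions_of n. \<forall>x\<in>#M. m < x}"

definition partitions_above_fps :: "nat \<Rightarrow> int fps" where
  "partitions_above_fps m = Abs_fps (\<lambda>n. int (card (partitions_above m n)))"

lemma finite_partitions_above: "finite (partitions_above m n)"
  by (simp add: partitions_above_def finite_partitions_of)

lemma partitions_above_empty:
  assumes "0 < n" "n \<le> m"
  shows "partitions_above m n = {}"
proof -
  have False if "M \<in> partitions_above m n" for M
  proof (cases M)
    case (add x N)
    with that assms show False by (auto simp: partitions_above_def partitions_of_def)
  qed (use that assms in \<open>simp add: partitions_above_def partitions_of_def\<close>)
  then show ?thesis by blast
qed

lemma partitions_above_split:
  assumes "m < n"
  shows "partitions_above m n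
      = partitions_above (Suc m) n \<union> add_mset (Suc m) ` partitions_above m (n - Suc m)"
proof (intro equalityI subsetI)
  fix M assume M_in: "M \<in> partitions_above m n"
  show "M \<in> partitions_above (Suc m) n \<union> add_mset (Suc m) ` partitions_above m (n - Suc m)"
  proof (cases "Suc m \<in># M")
    case True
    then obtain N where "M = add_mset (Suc m) N" by (meson multi_member_split)
    with M_in show ?thesis by (auto simp: partitions_above_def partitions_of_def)
  next
    case False
    with M_in have "M \<in> partitions_above (Suc m) n"
      unfolding partitions_above_def using Suc_lessI by blast
    then show ?thesis ..
  qed
qed (use assms in \<open>auto simp: partitions_above_def partitions_of_def\<close>)

lemma card_partitions_above:
  "card (partitions_above m n) = card (partitions_above (Suc m) n) +
     (if m < n then card (partitions_above m (n - Suc m)) else 0)"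
proof (cases "m < n")
  case True
  have "partitions_above (Suc m) n \<inter> add_mset (Suc m) ` partitions_above m (n - Suc m) = {}"
    by (auto simp: partitions_above_def)
  moreover have "card (add_mset (Suc m) ` partitions_above m (n - Suc m))
      = card (partitions_above m (n - Suc m))"
    by (intro card_image) (auto simp: inj_on_def)
  ultimately show ?thesis
    using True by (simp add: partitions_above_split card_Un_disjoint finite_partitions_above)
next
  case False
  have "partitions_above m n = partitions_above (Suc m) n"
    using False
    by (cases "n = 0") (auto simp: partitions_above_empty partitions_above_def[of _ 0] partitions_of_0)
  with False show ?thesis by simp
qed

lemma partitions_above_fps_Suc:
  "partitions_above_fps (Suc m) = partitions_above_fps m * (1 - fps_X ^ Suc m)"
proof (rule fps_ext)
  fix n
  have "(partitions_above_fps m * (1 - fps_X ^ Suc m)) $ n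
      = partitions_above_fps m $ n - (if n < Suc m then 0 else partitions_above_fps m $ (n - Suc m))"
    by (simp only: right_diff_distrib mult_1_right fps_sub_nth fps_X_power_mult_right_nth)
  then show "partitions_above_fps (Suc m) $ n = (partitions_above_fps m * (1 - fps_X ^ Suc m)) $ n"
    by (auto simp: partitions_above_fps_def card_partitions_above[of m n])
qed

lemma partition_fps_mult_prod:
  "partition_fps * (\<Prod>j=1..m. 1 - fps_X ^ j) = partitions_above_fps m"
proof (induction m)
  case 0
  have "partitions_above 0 n = partitions_of n" for n
    by (auto simp: partitions_above_def partitions_of_def)
  then show ?case
    by (simp add: partition_fps_def partitions_above_fps_def partition_number_def)
next
  case (Suc m)
  then show ?case
    by (simp add: partitions_above_fps_Suc prod.nat_ivl_Suc' mult_ac del: power_Suc)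
qed

definition pentagonal :: "nat \<Rightarrow> nat" where
  "pentagonal j = j * (3 * j - 1) div 2"

lemma pentagonal_eq_triangle: "pentagonal (Suc i) = (Suc i)\<^sup>2 + triangle i"
proof -
  have "Suc i * (3 * Suc i - 1) = 2 * (Suc i)\<^sup>2 + i * Suc i"
    by (simp add: power2_eq_square algebra_simps)
  then show ?thesis by (simp add: pentagonal_def triangle_def)
qed

lemma pentagonal_0: "pentagonal 0 = 0"
  by (simp add: pentagonal_def)

lemma pentagonal_Suc: "pentagonal (Suc j) = pentagonal j + 3 * j + 1"
  by (cases j) (simp_all add: pentagonal_0 pentagonal_eq_triangle power2_eq_square)

text \<open>Shanks' finite form of the pentagonal number theorem: as \<open>m\<close> grows, the product with \<open>s = 0\<close>
  dominates and the other summands move to high powers of \<open>x\<close>.\<close>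
definition shanks_sum :: "'a :: comm_ring_1 \<Rightarrow> nat \<Rightarrow> 'a" where
  "shanks_sum x m = (\<Sum>s\<le>m. (-1) ^ s * x ^ (s * m + triangle s) * (\<Prod>j=Suc s..m. 1 - x ^ j))"

lemma shanks_sum_Suc:
  "shanks_sum x (Suc m) = shanks_sum x m
     + (-1) ^ Suc m * (x ^ pentagonal (Suc m) + x ^ (pentagonal (Suc m) + Suc m))"
proof -
  define Q where "Q s = (\<Prod>j=Suc s..m. 1 - x ^ j)" for s
  define a where "a s = (-1) ^ s * x ^ (s * m + triangle s) * Q s" for s
  define c where "c s = (-1) ^ s * x ^ (s * Suc m + triangle s) * Q s" for s
  define d where "d s = (-1) ^ s * x ^ (Suc s * Suc m + triangle s) * Q s" for s
  have split_last: "(-1) ^ s * x ^ (s * Suc m + triangle s) * (\<Prod>j=Suc s..Suc m. 1 - x ^ j) = c s - d s"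
    if "s \<le> m" for s
  proof -
    have Q_snoc: "(\<Prod>j=Suc s..Suc m. 1 - x ^ j) = Q s * (1 - x ^ Suc m)"
      using that by (simp add: Q_def prod.nat_ivl_Suc' mult.commute)
    show ?thesis
      unfolding Q_snoc by (simp add: c_def d_def algebra_simps power_add)
  qed
  have telescope: "c (Suc r) = a (Suc r) + d r" if "r < m" for r
  proof -
    have Q_Cons: "Q r = (1 - x ^ Suc r) * Q (Suc r)"
      unfolding Q_def using that by (simp add: prod.atLeast_Suc_atMost)
    show ?thesis
      unfolding d_def Q_Cons by (simp add: c_def a_def algebra_simps power_add)
  qed
  have c_0: "c 0 = a 0" by (simp add: c_def a_def)
  have "(\<Sum>s\<le>m. c s) = c 0 + (\<Sum>r<m. c (Suc r))"
    by (simp add: sum.atMost_shift)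
  also have "\<dots> = a 0 + (\<Sum>r<m. a (Suc r)) + (\<Sum>r<m. d r)"
    using telescope by (simp add: sum.distrib c_0)
  also have "\<dots> = (\<Sum>s\<le>m. a s) + (\<Sum>r<m. d r)"
    by (simp add: sum.atMost_shift)
  finally have "(\<Sum>s\<le>m. c s - d s) = (\<Sum>s\<le>m. a s) - d m"
    by (simp add: sum_subtractf flip: lessThan_Suc_atMost)
  moreover have "shanks_sum x (Suc m)
      = (\<Sum>s\<le>m. c s - d s) + (-1) ^ Suc m * x ^ (pentagonal (Suc m) + Suc m)"
    using split_last by (simp add: shanks_sum_def pentagonal_eq_triangle power2_eq_square add_ac)
  moreover have "d m = (-1) ^ m * x ^ pentagonal (Suc m)"
    by (simp add: d_def Q_def pentagonal_eq_triangle power2_eq_square)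
  ultimately show ?thesis
    by (simp add: shanks_sum_def a_def Q_def algebra_simps)
qed

lemma shanks_identity:
  "shanks_sum x m = 1 + (\<Sum>j=1..m. (-1) ^ j * (x ^ pentagonal j + x ^ (pentagonal j + j)))"
  by (induction m) (simp_all add: shanks_sum_Suc shanks_sum_def[of x 0] add.assoc)

lemma partition_fps_mult_shanks_sum:
  assumes "0 < n"
  shows "(partition_fps * shanks_sum (fps_X :: int fps) n) $ n = 0"
proof -
  define T :: "nat \<Rightarrow> int fps"
    where "T s = (-1) ^ s * fps_X ^ (s * n + triangle s) * (\<Prod>j=Suc s..n. 1 - fps_X ^ j)" for s
  have "(partition_fps * T s) $ n = 0" if "s \<le> n" for s
  proof (cases s)
    case 0
    then have "partition_fps * T s = partitions_above_fps n"
      using partition_fps_mult_prod[of n] by (simp add: T_def)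
    then show ?thesis
      using assms by (simp add: partitions_above_fps_def partitions_above_empty)
  next
    case (Suc r)
    have "partition_fps * T s
        = (partition_fps * ((-1) ^ s * (\<Prod>j=Suc s..n. 1 - fps_X ^ j))) * fps_X ^ (s * n + triangle s)"
      by (simp add: T_def mult_ac)
    moreover have "n < s * n + triangle s" by (simp add: Suc)
    ultimately show ?thesis by (simp only: fps_X_power_mult_right_nth if_True)
  qed
  then show ?thesis
    by (simp add: shanks_sum_def T_def[symmetric] sum_distrib_left fps_sum_nth)
qed

definition lagged_partition_number :: "nat \<Rightarrow> nat \<Rightarrow> int" where
  "lagged_partition_number n g = (if g \<le> n then int (partition_number (n - g)) else 0)"

lemma partition_number_pentagonal:
  assumes "0 < n"
  shows "int (partition_number n) = (\<Sum>j=1..n. (-1) ^ Suc j *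
     (lagged_partition_number n (pentagonal j) + lagged_partition_number n (pentagonal j + j)))"
proof -
  have lag: "(partition_fps * fps_X ^ g) $ n = lagged_partition_number n g" for g
    by (simp add: fps_X_power_mult_right_nth lagged_partition_number_def partition_fps_def)
  have sign: "(f * ((-1) ^ k * h)) $ n = (-1) ^ k * (f * h) $ n" for f h :: "int fps" and k
    by (cases "even k") auto
  have "0 = (partition_fps * shanks_sum (fps_X :: int fps) n) $ n"
    using partition_fps_mult_shanks_sum[OF assms] ..
  also have "\<dots> = int (partition_number n) + (\<Sum>j=1..n. (-1) ^ j *
     (lagged_partition_number n (pentagonal j) + lagged_partition_number n (pentagonal j + j)))"
    unfolding shanks_identity distrib_left[of partition_fps] sum_distrib_left fps_add_nth fps_sum_nth
      sign lag
    by (simp add: partition_fps_def)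
  finally show ?thesis by (simp add: sum_negf)
qed

section \<open>Small values\<close>

definition nearly_log_concave_at :: "nat \<Rightarrow> bool" where
  "nearly_log_concave_at n \<longleftrightarrow>
     n * (partition_number n)\<^sup>2 < (n + 1) * (partition_number (n - 1) * partition_number (n + 1))"

text \<open>Evaluates the recurrence on the list \<open>p(n), p(n - 1), \<dots>, p(0)\<close>: \<open>d\<close> counts the entries to be
  skipped before the lag \<open>pentagonal (j + 1)\<close>, respectively \<open>pentagonal (j + 1) + (j + 1)\<close>, is reached.\<close>
fun lower_walk and upper_walk :: "int \<Rightarrow> int \<Rightarrow> nat \<Rightarrow> nat \<Rightarrow> int list \<Rightarrow> int" where
  "lower_walk s e j d [] = s"
| "lower_walk s e j (Suc d) (x # xs) = lower_walk s e j d xs"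
| "lower_walk s e j 0 (x # xs) = upper_walk (s + e * x) e j j xs"
| "upper_walk s e j d [] = s"
| "upper_walk s e j (Suc d) (x # xs) = upper_walk s e j d xs"
| "upper_walk s e j 0 (x # xs) = lower_walk (s + e * x) (- e) (Suc j) (Suc (Suc (j + j))) xs"

lemma lower_walk_drop: "lower_walk s e j d xs = lower_walk s e j 0 (drop d xs)"
proof (induction d arbitrary: xs)
  case (Suc d)
  then show ?case by (cases xs) simp_all
qed simp

lemma upper_walk_drop: "upper_walk s e j d xs = upper_walk s e j 0 (drop d xs)"
proof (induction d arbitrary: xs)
  case (Suc d)
  then show ?case by (cases xs) simp_all
qed simp

lemma lower_walk_round:
  "lower_walk s e j d xs
     = lower_walk (s + e * (nth_default 0 xs d + nth_default 0 xs (d + Suc j))) (- e) (Suc j) (2 * Suc j)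
         (drop (d + j + 2) xs)"
proof (cases "d < length xs")
  case True
  then have lower: "lower_walk s e j d xs = upper_walk (s + e * xs ! d) e j 0 (drop (Suc d + j) xs)"
    by (simp add: lower_walk_drop[of _ _ _ d] upper_walk_drop[of _ _ _ j] add.commute
          flip: Cons_nth_drop_Suc)
  show ?thesis
  proof (cases "Suc d + j < length xs")
    case True
    then show ?thesis
      using lower by (simp add: nth_default_def distrib_left add.assoc mult_2 flip: Cons_nth_drop_Suc)
  next
    case False
    then show ?thesis
      using lower \<open>d < length xs\<close> by (simp add: nth_default_def)
  qed
qed (simp add: lower_walk_drop[of _ _ _ d] nth_default_def)

lemma lower_walk_eq_sum:
  assumes "length xs \<le> pentagonal (j + c) + (j + c)"
  shows "lower_walk s ((-1) ^ j) j (2 * j) (drop (pentagonal j + j) xs)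
    = s + (\<Sum>i=j..<j + c. (-1) ^ i * (nth_default 0 xs (pentagonal (Suc i) - 1)
                                       + nth_default 0 xs (pentagonal (Suc i) + i)))"
  using assms
proof (induction c arbitrary: s j)
  case (Suc c)
  have nth: "nth_default 0 (drop k xs) i = nth_default 0 xs (k + i)" for k i
    by (simp add: nth_default_def less_diff_conv add.commute)
  have "lower_walk s ((-1) ^ j) j (2 * j) (drop (pentagonal j + j) xs)
      = lower_walk (s + (-1) ^ j * (nth_default 0 xs (pentagonal (Suc j) - 1)
                                    + nth_default 0 xs (pentagonal (Suc j) + j)))
          ((-1) ^ Suc j) (Suc j) (2 * Suc j) (drop (pentagonal (Suc j) + Suc j) xs)"
    by (subst lower_walk_round) (simp add: nth pentagonal_Suc algebra_simps)
  also have "\<dots> = s + (\<Sum>i=j..<j + Suc c. (-1) ^ i * (nth_default 0 xs (pentagonal (Suc i) - 1)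
                                                 + nth_default 0 xs (pentagonal (Suc i) + i)))"
    using Suc.IH[of "Suc j"] Suc.prems by (simp add: sum.atLeast_Suc_lessThan)
  finally show ?case .
qed simp

definition partition_numbers_upto :: "nat \<Rightarrow> int list" where
  "partition_numbers_upto n = map (\<lambda>k. int (partition_number k)) (rev [0..<Suc n])"

lemma partition_numbers_upto_Suc:
  "partition_numbers_upto (Suc n) = int (partition_number (Suc n)) # partition_numbers_upto n"
  by (simp add: partition_numbers_upto_def)

lemma nth_default_partition_numbers_upto:
  "nth_default 0 (partition_numbers_upto n) g = lagged_partition_number (Suc n) (Suc g)"
  by (simp add: partition_numbers_upto_def lagged_partition_number_def nth_default_def rev_nth
        del: upt_Suc)

lemma lower_walk_partition_numbers_upto:
  "lower_walk 0 1 0 0 (partition_numbers_upto n) = int (partition_number (Suc n))"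
proof -
  let ?ps = "partition_numbers_upto n"
  have "lower_walk 0 1 0 0 ?ps = (\<Sum>i<Suc n. (-1) ^ i *
      (nth_default 0 ?ps (pentagonal (Suc i) - 1) + nth_default 0 ?ps (pentagonal (Suc i) + i)))"
    using lower_walk_eq_sum[of ?ps 0 "Suc n" 0]
    by (simp add: pentagonal_0 atLeast0LessThan partition_numbers_upto_def)
  also have "\<dots> = (\<Sum>i<Suc n. (-1) ^ Suc (Suc i) *
      (lagged_partition_number (Suc n) (pentagonal (Suc i))
       + lagged_partition_number (Suc n) (pentagonal (Suc i) + Suc i)))"
    unfolding nth_default_partition_numbers_upto by (simp add: pentagonal_Suc)
  also have "\<dots> = int (partition_number (Suc n))"
    unfolding partition_number_pentagonal[OF zero_less_Suc]
    by (rule sum.reindex_bij_witness[of _ "\<lambda>j. j - 1" Suc]) auto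
  finally show ?thesis .
qed

text \<open>The new value is passed to \<open>check_next\<close> as an argument so that it is normalized once before it is
  duplicated.\<close>
fun check_from :: "nat \<Rightarrow> int \<Rightarrow> int list \<Rightarrow> bool"
  and check_next :: "nat \<Rightarrow> int \<Rightarrow> int \<Rightarrow> int list \<Rightarrow> bool" where
  "check_from 0 n xs = True"
| "check_from (Suc k) n xs = check_next k n (lower_walk 0 1 0 0 xs) xs"
| "check_next k n c (b # a # xs) =
     (n * (b * b) < (n + 1) * (a * c) \<and> check_from k (n + 1) (c # b # a # xs))"
| "check_next k n c [] = False"
| "check_next k n c [x] = False"

lemma check_from_sound:
  assumes "check_from k (int n) (partition_numbers_upto n)" "0 < n" "n \<le> m" "m < n + k"
  shows "nearly_log_concave_at m"
  using assms
proof (induction k arbitrary: n)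
  case (Suc k)
  let ?p = "\<lambda>k. int (partition_number k)"
  obtain l where n_eq: "n = Suc l" using Suc.prems(2) gr0_implies_Suc by blast
  obtain qs where ps_eq: "partition_numbers_upto n = ?p n # ?p l # qs"
    by (cases l) (simp_all add: n_eq partition_numbers_upto_def)
  have "check_next k (int n) (?p (Suc n)) (partition_numbers_upto n)"
    using Suc.prems(1) by (simp only: check_from.simps lower_walk_partition_numbers_upto)
  then have holds_at_n: "int n * (?p n * ?p n) < (int n + 1) * (?p l * ?p (Suc n))"
    and check_later: "check_from k (int (Suc n)) (partition_numbers_upto (Suc n))"
    by (simp_all add: ps_eq partition_numbers_upto_Suc add.commute)
  show ?case
  proof (cases "m = n")
    case True
    have "int (m * (partition_number m)\<^sup>2)
        < int ((m + 1) * (partition_number (m - 1) * partition_number (m + 1)))"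
      using holds_at_n by (simp add: True n_eq power2_eq_square algebra_simps)
    then show ?thesis unfolding nearly_log_concave_at_def by (simp only: of_nat_less_iff)
  qed (use Suc.IH[OF check_later] Suc.prems in auto)
qed simp

lemma nearly_log_concave_at_small:
  assumes "1 \<le> n" "n < 800"
  shows "nearly_log_concave_at n"
proof (rule check_from_sound)
  have "partition_number 0 = 1" "partition_number 1 = 1"
    using lower_walk_partition_numbers_upto[of 0]
    by (simp_all add: partition_numbers_upto_def partition_number_def partitions_of_0)
  then have "partition_numbers_upto 1 = [1, 1]"
    by (simp add: partition_numbers_upto_def)
  moreover have "check_from 799 1 [1, 1]"
    by code_simp
  ultimately show "check_from 799 (int 1) (partition_numbers_upto 1)"
    by simp
qed (use assms in auto)

section \<open>Moments of the logarithm of the generating function\<close>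

lemma summable_power_mult_power:
  fixes x :: "'a :: {real_normed_field, banach}"
  assumes "norm x < 1"
  shows "summable (\<lambda>k. of_nat k ^ j * x ^ k)"
  using assms
proof (induction j arbitrary: x)
  case 0
  then show ?case by (simp add: summable_geometric)
next
  case (Suc j)
  have "summable (\<lambda>k. diffs (\<lambda>k. of_nat k ^ j) k * x ^ k)"
    using Suc.prems by (rule termdiff_converges) (rule Suc.IH)
  then have "summable (\<lambda>k. of_nat (Suc k) ^ Suc j * x ^ k * x)"
    unfolding diffs_def power_Suc[of "of_nat _"] by (rule summable_mult2)
  then have "summable (\<lambda>k. of_nat (Suc k) ^ Suc j * x ^ Suc k)"
    by (simp only: power_Suc2[of x] mult.assoc)
  then show ?case by (rule summable_Suc_iff[THEN iffD1])
qed

lemma power_mult_power_sums_step: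
  fixes x :: "'a :: {real_normed_field, banach}"
  assumes norm_x: "norm x < 1" and j_pos: "0 < j"
    and difference_sums: "(\<lambda>k. ((of_nat k + 1) ^ j - of_nat k ^ j) * x ^ k) sums T"
  shows "(\<lambda>k. of_nat k ^ j * x ^ k) sums (T * x / (1 - x))"
proof -
  define S where "S = (\<Sum>k. of_nat k ^ j * x ^ k)"
  have S_sums: "(\<lambda>k. of_nat k ^ j * x ^ k) sums S"
    unfolding S_def using summable_power_mult_power[OF norm_x] by (rule summable_sums)
  then have "(\<lambda>k. of_nat (Suc k) ^ j * x ^ Suc k) sums S"
    using j_pos by (subst sums_Suc_iff) (simp add: power_0_left)
  moreover have "(\<lambda>k. (of_nat k ^ j * x ^ k + ((of_nat k + 1) ^ j - of_nat k ^ j) * x ^ k) * x)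
      sums ((S + T) * x)"
    by (intro sums_mult2 sums_add S_sums difference_sums)
  then have "(\<lambda>k. of_nat (Suc k) ^ j * x ^ Suc k) sums ((S + T) * x)"
    by (simp add: algebra_simps)
  ultimately have "S = (S + T) * x" by (rule sums_unique2)
  then have "S * (1 - x) = T * x" by (simp add: algebra_simps)
  moreover have "1 - x \<noteq> 0" using norm_x by auto
  ultimately have "S = T * x / (1 - x)" by (simp add: eq_divide_eq)
  with S_sums show ?thesis by simp
qed

lemma nat_mult_power_sums:
  fixes x :: "'a :: {real_normed_field, banach}"
  assumes "norm x < 1"
  shows "(\<lambda>k. of_nat k * x ^ k) sums (x / (1 - x)\<^sup>2)"
  using power_mult_power_sums_step[of x 1 "1 / (1 - x)"] geometric_sums[OF assms] assms
  by (simp add: power2_eq_square)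

lemma nat_square_mult_power_sums:
  fixes x :: "'a :: {real_normed_field, banach}"
  assumes "norm x < 1"
  shows "(\<lambda>k. of_nat k ^ 2 * x ^ k) sums (x * (1 + x) / (1 - x) ^ 3)"
proof -
  define r where "r = 1 - x"
  have r_nonzero: "r \<noteq> 0" using assms by (auto simp: r_def)
  have "(\<lambda>k. 2 * (of_nat k * x ^ k) + x ^ k) sums (2 * (x / r\<^sup>2) + 1 / r)"
    unfolding r_def by (intro sums_add sums_mult nat_mult_power_sums geometric_sums assms)
  then have "(\<lambda>k. of_nat k ^ 2 * x ^ k) sums ((2 * (x / r\<^sup>2) + 1 / r) * x / r)"
    unfolding r_def using assms
    by (intro power_mult_power_sums_step) (simp_all add: power2_eq_square algebra_simps)
  also have "(2 * (x / r\<^sup>2) + 1 / r) * x / r = x * (2 * x + r) / r ^ 3"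
    using r_nonzero by (simp add: field_simps eval_nat_numeral)
  also have "2 * x + r = 1 + x" by (simp add: r_def)
  finally show ?thesis by (simp only: r_def)
qed

lemma nat_cube_mult_power_sums:
  fixes x :: "'a :: {real_normed_field, banach}"
  assumes "norm x < 1"
  shows "(\<lambda>k. of_nat k ^ 3 * x ^ k) sums (x * (1 + 4 * x + x\<^sup>2) / (1 - x) ^ 4)"
proof -
  define r where "r = 1 - x"
  have r_nonzero: "r \<noteq> 0" using assms by (auto simp: r_def)
  let ?T = "3 * (x * (1 + x) / r ^ 3) + 3 * (x / r\<^sup>2) + 1 / r"
  have "(\<lambda>k. 3 * (of_nat k ^ 2 * x ^ k) + 3 * (of_nat k * x ^ k) + x ^ k) sums ?T"
    unfolding r_def
    by (intro sums_add sums_mult nat_square_mult_power_sums nat_mult_power_sums geometric_sums assms)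
  then have "(\<lambda>k. of_nat k ^ 3 * x ^ k) sums (?T * x / r)"
    unfolding r_def using assms
    by (intro power_mult_power_sums_step) (simp_all add: power2_eq_square power3_eq_cube algebra_simps)
  also have "?T * x / r = x * (3 * x * (1 + x) + 3 * x * r + r\<^sup>2) / r ^ 4"
    using r_nonzero by (simp add: field_simps eval_nat_numeral)
  also have "3 * x * (1 + x) + 3 * x * r + r\<^sup>2 = 1 + 4 * x + x\<^sup>2"
    by (simp add: r_def power2_eq_square algebra_simps)
  finally show ?thesis by (simp only: r_def)
qed

lemma cosh_real_gt_1: "0 < t \<Longrightarrow> 1 < cosh t" for t :: real
  by (simp add: less_le cosh_real_ge_1)

lemma cosh_ge_taylor: "1 + x\<^sup>2 / 2 + x ^ 4 / 24 + x ^ 6 / 720 \<le> cosh x" for x :: real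
proof -
  have "(\<Sum>n<7. if even n then x ^ n /\<^sub>R fact n else 0) \<le> cosh x"
    using cosh_converges[of x]
    by (intro sum_le_suminf[THEN order_trans]) (auto simp: sums_iff zero_le_even_power)
  moreover have "{..<7} = {0, 1, 2, 3, 4, 5, 6 :: nat}" by auto
  ultimately show ?thesis by (simp add: fact_numeral field_simps)
qed

lemma exponential_moment_sums:
  fixes s :: real
  assumes "0 < s"
  shows "(\<lambda>k. real k * exp (- s) ^ k) sums (1 / (2 * (cosh s - 1)))"
    and "(\<lambda>k. real k ^ 2 * exp (- s) ^ k) sums (sinh s / (2 * (cosh s - 1)\<^sup>2))"
    and "(\<lambda>k. real k ^ 3 * exp (- s) ^ k) sums ((cosh s + 2) / (2 * (cosh s - 1)\<^sup>2))"
proof -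
  define q where "q = exp (- s)"
  have q_bounds: "0 < q" "q < 1" using assms by (auto simp: q_def)
  define r where "r = 1 - q"
  have r_nonzero: "r \<noteq> 0" and r_eq: "r = 1 - q" using q_bounds by (auto simp: r_def)
  have exp_s: "exp s = 1 / q" by (simp add: q_def exp_minus field_simps)
  have cosh: "cosh s - 1 = r\<^sup>2 / (2 * q)" "cosh s + 2 = (1 + 4 * q + q\<^sup>2) / (2 * q)"
    and sinh: "sinh s = r * (1 + q) / (2 * q)"
    using q_bounds
    by (simp_all add: r_eq cosh_field_def sinh_field_def exp_s q_def[symmetric] field_simps power2_eq_square)
  have "1 / (2 * (cosh s - 1)) = q / r\<^sup>2"
    "sinh s / (2 * (cosh s - 1)\<^sup>2) = q * (1 + q) / r ^ 3"
    "(cosh s + 2) / (2 * (cosh s - 1)\<^sup>2) = q * (1 + 4 * q + q\<^sup>2) / r ^ 4"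
    unfolding cosh sinh using q_bounds r_nonzero by (simp_all add: field_simps eval_nat_numeral)
  then show "(\<lambda>k. real k * exp (- s) ^ k) sums (1 / (2 * (cosh s - 1)))"
    "(\<lambda>k. real k ^ 2 * exp (- s) ^ k) sums (sinh s / (2 * (cosh s - 1)\<^sup>2))"
    "(\<lambda>k. real k ^ 3 * exp (- s) ^ k) sums ((cosh s + 2) / (2 * (cosh s - 1)\<^sup>2))"
    using nat_mult_power_sums[of q] nat_square_mult_power_sums[of q] nat_cube_mult_power_sums[of q]
      q_bounds
    unfolding r_eq by (simp_all add: q_def)
qed

lemma add_mult_le_cube:
  fixes u y :: real
  assumes "1 \<le> y" "u \<le> 12 * (y - 1)"
  shows "u * y + 4 \<le> 4 * y ^ 3"
proof -
  have "u * y \<le> 12 * (y - 1) * y"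
    using assms by (intro mult_right_mono) auto
  moreover have "0 \<le> (y - 1) ^ 3" using assms by simp
  then have "12 * (y - 1) * y + 4 \<le> 4 * y ^ 3" by (simp add: power3_eq_cube algebra_simps)
  ultimately show ?thesis by linarith
qed

lemma add_mult_le_square:
  fixes v y :: real
  assumes "0 \<le> v" "1 + v + 2 / 5 * v\<^sup>2 \<le> y"
  shows "12 * v * y + 6 \<le> 25 / 4 * y\<^sup>2"
proof -
  define u where "u = 5 / 2 * (1 + v + 2 / 5 * v\<^sup>2) - 12 / 5 * v"
  have "0 \<le> u" using assms(1) by (simp add: u_def)
  then have "u\<^sup>2 \<le> (5 / 2 * y - 12 / 5 * v)\<^sup>2"
    using assms(2) by (intro power_mono) (auto simp: u_def)
  moreover have "u\<^sup>2 = 6 + 144 / 25 * v\<^sup>2 + ((v\<^sup>2 - 1 / 2)\<^sup>2 + v\<^sup>2 / 4 + v / 2 + v ^ 3 / 5)"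
    by (simp add: u_def power2_eq_square power3_eq_cube algebra_simps)
  moreover have "0 \<le> (v\<^sup>2 - 1 / 2)\<^sup>2 + v\<^sup>2 / 4 + v / 2 + v ^ 3 / 5"
    using assms(1) by simp
  ultimately show ?thesis by (simp add: power2_eq_square algebra_simps)
qed

lemma cosh_minus_one_factor:
  fixes s :: real
  assumes "0 < s"
  obtains v y where "0 < v" "s\<^sup>2 = 12 * v" "2 * (cosh s - 1) = s\<^sup>2 * y" "1 + v + 2 / 5 * v\<^sup>2 \<le> y"
proof
  have "s\<^sup>2 * (1 + s\<^sup>2 / 12 + 2 / 5 * (s\<^sup>2 / 12)\<^sup>2) \<le> 2 * (cosh s - 1)"
    using cosh_ge_taylor[of s] by (simp add: power_divide algebra_simps flip: power_mult power_add)
  then show "1 + s\<^sup>2 / 12 + 2 / 5 * (s\<^sup>2 / 12)\<^sup>2 \<le> 2 * (cosh s - 1) / s\<^sup>2"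
    using assms by (simp add: pos_le_divide_eq mult.commute)
qed (use assms in simp_all)

lemma square_le_cosh_minus_one:
  fixes s :: real
  assumes "0 < s"
  shows "s\<^sup>2 \<le> 2 * (cosh s - 1)"
proof -
  obtain v y where v_pos: "0 < v" and cosh_eq: "2 * (cosh s - 1) = s\<^sup>2 * y"
    and y_ge: "1 + v + 2 / 5 * v\<^sup>2 \<le> y"
    using cosh_minus_one_factor[OF assms] by metis
  have "1 \<le> y" using v_pos y_ge zero_le_power2[of v] by linarith
  then show ?thesis unfolding cosh_eq by (simp add: mult_le_cancel_left1)
qed

lemma second_exponential_moment_le:
  fixes s :: real
  assumes "0 < s"
  shows "sinh s / (2 * (cosh s - 1)\<^sup>2) \<le> 2 / s ^ 3"
proof -
  define c where "c = cosh s - 1"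
  obtain v y where v_pos: "0 < v" and s_square: "s\<^sup>2 = 12 * v"
    and c_eq: "2 * c = s\<^sup>2 * y" and y_ge: "1 + v + 2 / 5 * v\<^sup>2 \<le> y"
    unfolding c_def using assms by (rule cosh_minus_one_factor)
  have c_pos: "0 < c" using assms by (simp add: c_def cosh_real_gt_1)
  have "1 + v \<le> y" using y_ge zero_le_power2[of v] by linarith
  then have y_bounds: "1 \<le> y" "s\<^sup>2 \<le> 12 * (y - 1)" using v_pos s_square by simp_all
  have "(sinh s)\<^sup>2 = c * (c + 2)"
    using cosh_square_eq[of s] by (simp add: c_def power2_eq_square algebra_simps)
  then have "4 * (sinh s * s ^ 3)\<^sup>2 = s ^ 6 * (2 * c) * (2 * c + 4)"
    by (simp add: power_mult_distrib algebra_simps flip: power_mult)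
  also have "\<dots> \<le> s ^ 6 * (2 * c) * (4 * y ^ 3)"
    using add_mult_le_cube[OF y_bounds] y_bounds c_pos by (intro mult_left_mono) (auto simp: c_eq)
  also have "\<dots> = 4 * (2 * c) * (s\<^sup>2 * y) ^ 3"
    by (simp add: power_mult_distrib flip: power_mult)
  also have "\<dots> = 4 * (4 * c\<^sup>2)\<^sup>2"
    unfolding c_eq[symmetric] by (simp add: power2_eq_square power3_eq_cube)
  finally have "(sinh s * s ^ 3)\<^sup>2 \<le> (4 * c\<^sup>2)\<^sup>2"
    by (simp only: mult_le_cancel_left_pos zero_less_numeral)
  then have "sinh s * s ^ 3 \<le> 4 * c\<^sup>2" by (rule power2_le_imp_le) simp
  then show ?thesis
    using assms c_pos unfolding c_def[symmetric] by (simp add: field_simps)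
qed

lemma third_exponential_moment_le:
  fixes s :: real
  assumes "0 < s"
  shows "(cosh s + 2) / (2 * (cosh s - 1)\<^sup>2) \<le> (25 / 4) / s ^ 4"
proof -
  define c where "c = cosh s - 1"
  obtain v y where v_pos: "0 < v" and s_square: "s\<^sup>2 = 12 * v"
    and c_eq: "2 * c = s\<^sup>2 * y" and y_ge: "1 + v + 2 / 5 * v\<^sup>2 \<le> y"
    unfolding c_def using assms by (rule cosh_minus_one_factor)
  have c_pos: "0 < c" using assms by (simp add: c_def cosh_real_gt_1)
  have "12 * v * y + 6 \<le> 25 / 4 * y\<^sup>2"
    using v_pos y_ge by (intro add_mult_le_square) auto
  then have "s ^ 4 * (2 * c + 6) \<le> s ^ 4 * (25 / 4 * y\<^sup>2)"
    by (intro mult_left_mono) (auto simp: c_eq s_square)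
  also have "\<dots> = 25 / 4 * (s\<^sup>2 * y)\<^sup>2"
    by (simp add: power_mult_distrib flip: power_mult)
  also have "\<dots> = 25 * c\<^sup>2"
    unfolding c_eq[symmetric] by (simp add: power2_eq_square)
  finally have "(c + 3) / (2 * c\<^sup>2) \<le> (25 / 4) / s ^ 4"
    using assms c_pos by (simp add: field_simps)
  then show ?thesis by (simp add: c_def add.commute)
qed

definition log_coeff :: "nat \<Rightarrow> real" where
  "log_coeff N = real (divisor_sum N) / real N"

definition log_moment :: "nat \<Rightarrow> real \<Rightarrow> real" where
  "log_moment j t = (\<Sum>N. real N ^ j * log_coeff N * exp (- t) ^ N)"

lemma log_coeff_nonneg: "0 \<le> log_coeff N"
  by (simp add: log_coeff_def)

lemma log_coeff_0: "log_coeff 0 = 0"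
  by (simp add: log_coeff_def)

lemma log_coeff_ge_1:
  assumes "0 < N" shows "1 \<le> log_coeff N"
proof -
  have "\<Sum>{N} \<le> \<Sum>{d. d dvd N}"
    using assms by (intro sum_mono2) (auto intro: finite_divisors_nat)
  then have "real N \<le> real (divisor_sum N)" by (simp only: divisor_sum_def of_nat_le_iff) simp
  then show ?thesis using assms by (simp add: log_coeff_def)
qed

lemma log_coeff_le: "log_coeff N \<le> real N"
proof (cases "N = 0")
  case False
  have "\<Sum>{d. d dvd N} \<le> (\<Sum>d=1..N. d)"
    using False by (intro sum_mono2) (auto dest: dvd_imp_le intro!: Suc_leI Nat.gr0I)
  also have "\<dots> \<le> (\<Sum>d=1..N. N)"
    by (intro sum_mono) simp
  finally have "real (divisor_sum N) \<le> real (N * N)"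
    by (simp only: divisor_sum_def of_nat_le_iff) simp
  then show ?thesis using False by (simp add: log_coeff_def field_simps)
qed (simp add: log_coeff_def)

lemma summable_norm_log_coeff:
  fixes z :: "'a :: {real_normed_field, banach}"
  assumes "norm z < 1"
  shows "summable (\<lambda>N. norm (of_nat N ^ j * of_real (log_coeff N) * z ^ N))"
proof (rule summable_comparison_test')
  show "summable (\<lambda>N. real N ^ Suc j * norm z ^ N)"
    using summable_power_mult_power[of "norm z" "Suc j"] assms by simp
  show "norm (norm (of_nat N ^ j * of_real (log_coeff N) * z ^ N)) \<le> real N ^ Suc j * norm z ^ N" for N
    using log_coeff_le[of N] log_coeff_nonneg[of N]
    by (simp add: norm_mult norm_power mult_mono mult.commute)
qed

lemma summable_log_moment:
  assumes "0 < t"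
  shows "summable (\<lambda>N. real N ^ j * log_coeff N * exp (- t) ^ N)"
  using summable_norm_cancel[OF summable_norm_log_coeff[of "exp (- t)" j]] assms by simp

lemma sum_log_coeff_le:
  fixes x :: real
  assumes "0 \<le> x"
  shows "(\<Sum>N=1..M. real N ^ Suc i * log_coeff N * x ^ N)
     \<le> (\<Sum>m=1..M. real m ^ i * (\<Sum>d=1..M. real d ^ Suc i * (x ^ m) ^ d))"
proof -
  let ?f = "\<lambda>d m. real m ^ i * (real d ^ Suc i * (x ^ m) ^ d)"
  have "real N ^ Suc i * log_coeff N * x ^ N = (\<Sum>d | d dvd N. ?f d (N div d))" if "N \<in> {1..M}" for N
  proof -
    have "real N ^ i * x ^ N * real d = ?f d (N div d)" if "d dvd N" for d
      using that by (auto simp: power_mult_distrib mult_ac simp flip: power_mult)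
    then have "(\<Sum>d | d dvd N. real N ^ i * x ^ N * real d) = (\<Sum>d | d dvd N. ?f d (N div d))"
      by (intro sum.cong) auto
    moreover have "real N ^ Suc i * log_coeff N * x ^ N = real N ^ i * x ^ N * real (divisor_sum N)"
      using that by (simp add: log_coeff_def)
    ultimately show ?thesis
      by (simp add: divisor_sum_def sum_distrib_left)
  qed
  then have "(\<Sum>N=1..M. real N ^ Suc i * log_coeff N * x ^ N) = (\<Sum>N=1..M. \<Sum>d | d dvd N. ?f d (N div d))"
    by (rule sum.cong[OF refl])
  also have "\<dots> = (\<Sum>d=1..M. \<Sum>m=1..M div d. ?f d m)"
    by (rule sum_divisors)
  also have "\<dots> \<le> (\<Sum>d=1..M. \<Sum>m=1..M. ?f d m)"
    using assms by (intro sum_mono sum_mono2) (auto intro: order_trans[OF _ div_le_dividend])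
  also have "\<dots> = (\<Sum>m=1..M. real m ^ i * (\<Sum>d=1..M. real d ^ Suc i * (x ^ m) ^ d))"
    by (subst sum.swap) (simp add: sum_distrib_left)
  finally show ?thesis .
qed

lemma sum_inverse_squares_le: "(\<Sum>m=1..M. 1 / real m ^ 2) \<le> pi\<^sup>2 / 6"
proof -
  have "(\<Sum>m=1..M. 1 / real m ^ 2) = (\<Sum>m<M. 1 / (real (Suc m))\<^sup>2)"
    by (rule sum.reindex_bij_witness[of _ Suc "\<lambda>m. m - 1"]) auto
  also have "\<dots> \<le> pi\<^sup>2 / 6"
    using inverse_squares_sums
    by (intro sum_le_suminf[THEN order_trans]) (auto simp: sums_iff add.commute)
  finally show ?thesis .
qed

lemma log_moment_le:
  fixes t c :: real
  assumes t_pos: "0 < t"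
    and sums: "\<And>s. 0 < s \<Longrightarrow> (\<lambda>k. real k ^ Suc i * exp (- s) ^ k) sums S s"
    and S_le: "\<And>s. 0 < s \<Longrightarrow> S s \<le> c / s ^ (i + 2)"
  shows "log_moment (Suc i) t \<le> pi\<^sup>2 / 6 * c / t ^ (i + 2)"
proof -
  have "0 \<le> S t"
    using sums[OF t_pos] by (rule sums_le[OF _ sums_zero, rotated]) simp
  then have bound_nonneg: "0 \<le> c / t ^ (i + 2)" using S_le[OF t_pos] by linarith
  have nonneg: "0 \<le> real N ^ Suc i * log_coeff N * exp (- t) ^ N" for N
    by (simp add: log_coeff_nonneg)
  have "(\<Sum>N<M. real N ^ Suc i * log_coeff N * exp (- t) ^ N) \<le> pi\<^sup>2 / 6 * c / t ^ (i + 2)" for M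
  proof -
    have "(\<Sum>N<M. real N ^ Suc i * log_coeff N * exp (- t) ^ N)
        \<le> (\<Sum>N=0..M. real N ^ Suc i * log_coeff N * exp (- t) ^ N)"
      using nonneg by (intro sum_mono2) auto
    also have "\<dots> = (\<Sum>N=1..M. real N ^ Suc i * log_coeff N * exp (- t) ^ N)"
      by (simp add: sum.atLeast_Suc_atMost)
    also have "\<dots> \<le> (\<Sum>m=1..M. real m ^ i * (\<Sum>d=1..M. real d ^ Suc i * (exp (- t) ^ m) ^ d))"
      by (rule sum_log_coeff_le) simp
    also have "\<dots> \<le> (\<Sum>m=1..M. real m ^ i * (c / (real m * t) ^ (i + 2)))"
    proof (intro sum_mono mult_left_mono)
      fix m assume "m \<in> {1..M}"
      then have mt_pos: "0 < real m * t" using t_pos by simp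
      have "(\<Sum>d=1..M. real d ^ Suc i * exp (- (real m * t)) ^ d) \<le> S (real m * t)"
        using sums[OF mt_pos] by (intro sum_le_suminf[THEN order_trans]) (auto simp: sums_iff)
      also note S_le[OF mt_pos]
      finally show "(\<Sum>d=1..M. real d ^ Suc i * (exp (- t) ^ m) ^ d) \<le> c / (real m * t) ^ (i + 2)"
        by (simp flip: exp_of_nat_mult)
    qed simp
    also have "\<dots> = c / t ^ (i + 2) * (\<Sum>m=1..M. 1 / real m ^ 2)"
      unfolding sum_distrib_left
      by (intro sum.cong refl) (simp add: power_mult_distrib power_add power2_eq_square field_simps)
    also have "\<dots> \<le> c / t ^ (i + 2) * (pi\<^sup>2 / 6)"
      using sum_inverse_squares_le bound_nonneg by (rule mult_left_mono)
    finally show ?thesis by (simp add: mult_ac)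
  qed
  then show ?thesis
    unfolding log_moment_def by (rule suminf_le_const[OF summable_log_moment[OF t_pos]])
qed

lemma log_moment_bounds:
  fixes t :: real
  assumes "0 < t"
  shows "log_moment 1 t \<le> pi\<^sup>2 / 6 / t\<^sup>2"
    and "log_moment 2 t \<le> pi\<^sup>2 / 6 * 2 / t ^ 3"
    and "log_moment 3 t \<le> pi\<^sup>2 / 6 * (25 / 4) / t ^ 4"
  using log_moment_le[OF assms, of 0 "\<lambda>s. 1 / (2 * (cosh s - 1))" 1]
    log_moment_le[OF assms, of 1 "\<lambda>s. sinh s / (2 * (cosh s - 1)\<^sup>2)" 2]
    log_moment_le[OF assms, of 2 "\<lambda>s. (cosh s + 2) / (2 * (cosh s - 1)\<^sup>2)" "25 / 4"]
    exponential_moment_sums square_le_cosh_minus_one second_exponential_moment_le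
    third_exponential_moment_le
  by (simp_all add: frac_le flip: numeral_2_eq_2 numeral_3_eq_3)

section \<open>The generating function and its Fourier coefficients\<close>

definition log_fps :: "complex fps" where
  "log_fps = Abs_fps (\<lambda>N. of_real (log_coeff N))"

definition log_gf :: "complex \<Rightarrow> complex" where
  "log_gf = eval_fps log_fps"

lemma fps_conv_radius_log_fps: "1 \<le> fps_conv_radius log_fps"
  unfolding fps_conv_radius_def
proof (rule conv_radius_geI_ex')
  fix r :: real assume "0 < r" "ereal r < 1"
  then show "summable (\<lambda>n. log_fps $ n * of_real r ^ n)"
    using summable_norm_cancel[OF summable_norm_log_coeff[of "complex_of_real r" 0]]
    by (simp add: log_fps_def one_ereal_def)
qed

lemma log_gf_sums:
  assumes "norm z < 1"
  shows "(\<lambda>N. of_real (log_coeff N) * z ^ N) sums log_gf z"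
proof -
  have "ereal (norm z) < fps_conv_radius log_fps"
    using assms by (intro less_le_trans[OF _ fps_conv_radius_log_fps]) (simp add: one_ereal_def)
  from sums_eval_fps[OF this] show ?thesis
    by (simp add: log_gf_def log_fps_def)
qed

lemma holomorphic_on_log_gf: "log_gf holomorphic_on ball 0 1"
  unfolding log_gf_def
  by (intro holomorphic_on_eval_fps)
     (auto simp: in_eball_iff intro!: less_le_trans[OF _ fps_conv_radius_log_fps])

lemma fps_linear_ODE_unique:
  fixes f g h :: "'a :: field_char_0 fps"
  assumes "fps_deriv f = h * f" "fps_deriv g = h * g" "f $ 0 = g $ 0" "g $ 0 \<noteq> 0"
  shows "f = g"
proof -
  have "g * inverse g = 1"
    using assms(4) by (simp add: inverse_mult_eq_1')
  then have "fps_deriv (f * inverse g) = 0"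
    using assms by (simp add: fps_inverse_deriv power2_eq_square)
  then have "f * inverse g = fps_const ((f * inverse g) $ 0)"
    by (simp only: fps_deriv_eq_0_iff)
  then have "f * inverse g = 1"
    using assms by simp
  then have "f * (g * inverse g) = g"
    by (simp add: mult_ac)
  then show ?thesis
    using \<open>g * inverse g = 1\<close> by simp
qed

lemma fps_deriv_partition_fps: "fps_deriv partition_fps = fps_deriv log_fps * partition_fps"
proof (rule fps_ext)
  fix n
  have coeff: "fps_deriv log_fps $ i = of_nat (divisor_sum (Suc i))" for i
  proof -
    have "real (Suc i) * log_coeff (Suc i) = real (divisor_sum (Suc i))"
      by (simp add: log_coeff_def del: of_nat_Suc)
    then have "of_real (real (Suc i) * log_coeff (Suc i))
        = (of_real (real (divisor_sum (Suc i))) :: complex)"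
      by (simp only:)
    then show ?thesis by (simp add: log_fps_def)
  qed
  have "fps_deriv partition_fps $ n = (of_nat (Suc n * partition_number (Suc n)) :: complex)"
    by (simp add: partition_fps_def algebra_simps)
  also have "\<dots> = of_nat (\<Sum>k=1..Suc n. divisor_sum k * partition_number (Suc n - k))"
    by (simp only: partition_number_divisor_sum)
  also have "\<dots> = of_nat (\<Sum>i=0..n. divisor_sum (Suc i) * partition_number (n - i))"
    by (intro arg_cong[where f = of_nat] sum.reindex_bij_witness[of _ Suc "\<lambda>k. k - 1"]) auto
  also have "\<dots> = (fps_deriv log_fps * partition_fps) $ n"
    unfolding fps_mult_nth coeff by (simp add: partition_fps_def)
  finally show "fps_deriv partition_fps $ n = (fps_deriv log_fps * partition_fps) $ n" .
qed

lemma partition_fps_eq_exp: "partition_fps = fps_exp 1 oo log_fps"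
proof (rule fps_linear_ODE_unique)
  have "log_fps $ 0 = 0" by (simp add: log_fps_def log_coeff_0)
  then show "fps_deriv (fps_exp 1 oo log_fps) = fps_deriv log_fps * (fps_exp 1 oo log_fps)"
    by (simp add: fps_compose_deriv)
  show "fps_deriv partition_fps = fps_deriv log_fps * partition_fps"
    by (rule fps_deriv_partition_fps)
qed (simp_all add: partition_fps_def partition_number_def partitions_of_0)

lemma partition_gf_sums:
  fixes z :: complex
  assumes "norm z < 1"
  shows "(\<lambda>n. of_nat (partition_number n) * z ^ n) sums exp (log_gf z)"
proof -
  have "0 < fps_conv_radius log_fps"
    using fps_conv_radius_log_fps by (rule less_le_trans[rotated]) simp
  then have "log_gf has_fps_expansion log_fps"
    by (simp add: log_gf_def has_fps_expansion_def)
  then have "(exp \<circ> log_gf) has_fps_expansion partition_fps"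
    unfolding partition_fps_eq_exp
    by (intro has_fps_expansion_compose has_fps_expansion_exp1) (simp_all add: log_fps_def log_coeff_0)
  moreover have "(exp \<circ> log_gf) holomorphic_on eball 0 1"
    using holomorphic_on_log_gf by (auto simp: o_def one_ereal_def intro!: holomorphic_intros)
  ultimately show ?thesis
    using has_fps_expansion_imp_sums_complex[of "exp \<circ> log_gf" partition_fps 1 z] assms
    by (simp add: partition_fps_def)
qed

lemma has_integral_cis:
  fixes j :: int
  shows "((\<lambda>\<theta>. cis (of_int j * \<theta>)) has_integral (if j = 0 then 2 * pi else 0)) {-pi..pi}"
proof (cases "j = 0")
  case True
  then show ?thesis
    using has_integral_const_real[of "1 :: complex" "-pi" pi] by (simp add: scaleR_conv_of_real)
next
  case False
  define F where "F \<theta> = cis (of_int j * \<theta>) / (\<i> * of_int j)" for \<theta>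
  have "((\<lambda>\<theta>. cis (of_int j * \<theta>)) has_integral (F pi - F (-pi))) {-pi..pi}"
  proof (rule fundamental_theorem_of_calculus)
    fix \<theta> :: real
    have cis_j: "cis (of_int j * x) = exp (\<i> * of_int j * of_real x)" for x
      by (simp add: cis_conv_exp mult_ac)
    have "((\<lambda>z. exp (\<i> * of_int j * z) / (\<i> * of_int j)) has_field_derivative
        exp (\<i> * of_int j * of_real \<theta>)) (at (of_real \<theta>))"
      using False by (auto intro!: derivative_eq_intros)
    then show "(F has_vector_derivative cis (of_int j * \<theta>)) (at \<theta> within {-pi..pi})"
      unfolding F_def[abs_def] cis_j by (intro has_vector_derivative_real_field)
  qed simp
  moreover have "F pi = F (-pi)"
  proof -
    have "sin (of_int j * pi) = 0" by (simp add: sin_zero_iff_int2)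
    then show ?thesis by (simp add: F_def complex_eq_iff cis.ctr)
  qed
  ultimately show ?thesis using False by simp
qed

lemma has_integral_fourier_coefficient:
  fixes a :: "nat \<Rightarrow> complex" and r :: real
  assumes "0 \<le> r" and summable: "summable (\<lambda>k. norm (a k) * r ^ k)"
    and sums: "\<And>\<theta>. (\<lambda>k. a k * (of_real r * cis \<theta>) ^ k) sums f \<theta>"
  shows "((\<lambda>\<theta>. f \<theta> * cis (- (of_nat m * \<theta>))) has_integral (2 * pi * a m * of_real r ^ m)) {-pi..pi}"
proof -
  define T where "T k \<theta> = a k * (of_real r * cis \<theta>) ^ k * cis (- (of_nat m * \<theta>))" for k \<theta>
  let ?c = "2 * pi * a m * of_real r ^ m"
  have "uniform_limit {-pi..pi} (\<lambda>K \<theta>. \<Sum>k<K. T k \<theta>) (\<lambda>\<theta>. \<Sum>k. T k \<theta>) sequentially"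
    using summable assms(1) by (intro Weierstrass_m_test) (auto simp: T_def norm_mult norm_power)
  then obtain I J where I_integral: "\<And>K. ((\<lambda>\<theta>. \<Sum>k<K. T k \<theta>) has_integral I K) {-pi..pi}"
    and J_integral: "((\<lambda>\<theta>. \<Sum>k. T k \<theta>) has_integral J) {-pi..pi}" and lim: "I \<longlonglongrightarrow> J"
    by (rule uniform_limit_integral) (auto simp: T_def intro!: continuous_intros)
  have "(T k has_integral (if k = m then ?c else 0)) {-pi..pi}" for k
  proof -
    have "T k = (\<lambda>\<theta>. a k * of_real r ^ k * cis (of_int (int k - int m) * \<theta>))"
      by (auto simp: T_def power_mult_distrib Complex.DeMoivre cis_mult algebra_simps)
    then show ?thesis
      using has_integral_mult_right[OF has_integral_cis[of "int k - int m"], of "a k * of_real r ^ k"]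
      by (auto simp: mult_ac)
  qed
  then have "((\<lambda>\<theta>. \<Sum>k<K. T k \<theta>) has_integral (\<Sum>k<K. if k = m then ?c else 0)) {-pi..pi}" for K
    by (intro has_integral_sum) auto
  then have I_eq: "I K = (\<Sum>k<K. if k = m then ?c else 0)" for K
    using I_integral has_integral_unique by blast
  have "\<forall>\<^sub>F K in sequentially. I K = ?c"
    using eventually_gt_at_top[of m] by eventually_elim (simp add: I_eq)
  then have "I \<longlonglongrightarrow> ?c" by (rule tendsto_eventually)
  then have "J = ?c" using lim LIMSEQ_unique by blast
  moreover have "(\<Sum>k. T k \<theta>) = f \<theta> * cis (- (of_nat m * \<theta>))" for \<theta>
    unfolding T_def using sums by (intro sums_unique[symmetric] sums_mult2)
  ultimately show ?thesis using J_integral by simp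
qed

section \<open>Decay and phase on the circle\<close>

definition decay :: "real \<Rightarrow> real \<Rightarrow> real" where
  "decay t \<theta> = (\<Sum>N. log_coeff N * exp (- t) ^ N * (1 - cos (real N * \<theta>)))"

definition phase :: "real \<Rightarrow> real \<Rightarrow> real" where
  "phase t \<theta> = (\<Sum>N. log_coeff N * exp (- t) ^ N * (sin (real N * \<theta>) - real N * \<theta>))"

lemma one_minus_cos_le: "1 - cos u \<le> u\<^sup>2 / 2" for u :: real
proof -
  have "(sin (u / 2))\<^sup>2 \<le> (u / 2)\<^sup>2"
    using abs_sin_x_le_abs_x[of "u / 2"] by (rule abs_le_square_iff[THEN iffD1])
  moreover have "cos u = 1 - 2 * (sin (u / 2))\<^sup>2"
    using cos_double_sin[of "u / 2"] by simp
  ultimately show ?thesis by (simp add: power_divide)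
qed

lemma abs_sin_minus_self_le: "\<bar>sin u - u\<bar> \<le> \<bar>u\<bar> ^ 3 / 6" for u :: real
proof -
  have "(\<Sum>m<3. sin_coeff m * u ^ m) = u"
    by (simp add: eval_nat_numeral sin_coeff_def)
  then show ?thesis
    using Maclaurin_sin_bound[of u 3] by (simp add: eval_nat_numeral)
qed

lemma one_minus_cos_ge:
  fixes u :: real
  assumes "0 \<le> u" "u \<le> 1"
  shows "u\<^sup>2 / 2 * (1 - u\<^sup>2 / 12) \<le> 1 - cos u"
proof -
  define v where "v = u / 2"
  have v_bounds: "0 \<le> v" "v \<le> 1" using assms by (auto simp: v_def)
  then have "v\<^sup>2 \<le> 1" by (simp add: power_le_one)
  have "v - v ^ 3 / 6 \<le> sin v"
    using abs_le_D2[OF abs_sin_minus_self_le[of v]] v_bounds(1) by (simp only: abs_of_nonneg)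
  moreover have "v - v ^ 3 / 6 = v * (1 - v\<^sup>2 / 6)"
    by (simp add: power2_eq_square power3_eq_cube algebra_simps)
  moreover have "0 \<le> v * (1 - v\<^sup>2 / 6)" using v_bounds \<open>v\<^sup>2 \<le> 1\<close> by simp
  ultimately have "(v * (1 - v\<^sup>2 / 6))\<^sup>2 \<le> (sin v)\<^sup>2"
    by (intro power_mono) auto
  moreover have "(v * (1 - v\<^sup>2 / 6))\<^sup>2 = v\<^sup>2 * (1 - v\<^sup>2 / 3) + v\<^sup>2 * (v\<^sup>2 / 6)\<^sup>2"
    by (simp add: power2_eq_square algebra_simps)
  moreover have "0 \<le> v\<^sup>2 * (v\<^sup>2 / 6)\<^sup>2" by simp
  ultimately have "v\<^sup>2 * (1 - v\<^sup>2 / 3) \<le> (sin v)\<^sup>2" by linarith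
  moreover have "1 - cos u = 2 * (sin v)\<^sup>2"
    using cos_double_sin[of v] by (simp add: v_def)
  ultimately show ?thesis by (simp add: v_def power_divide)
qed

lemma cosh_minus_one_le_sinh:
  fixes t :: real
  assumes "0 \<le> t"
  shows "2 * (cosh t - 1) \<le> t * sinh t"
proof (cases "t = 0")
  case False
  define u where "u = t / 2"
  have u_pos: "0 < u" and t_eq: "t = 2 * u" using assms False by (auto simp: u_def)
  have "(sinh has_real_derivative cosh x) (at x)" for x :: real
    by (auto intro!: derivative_eq_intros)
  then obtain z where z_mean_value: "0 < z" "z < u" "sinh u - sinh 0 = (u - 0) * cosh z"
    using MVT2[OF u_pos, of sinh cosh] by blast
  have "cosh z \<le> cosh u"
    using z_mean_value by (subst cosh_real_nonneg_le_iff) auto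
  then have "sinh u \<le> u * cosh u"
    using z_mean_value u_pos by simp
  then have "sinh u * sinh u \<le> u * cosh u * sinh u"
    using u_pos by (intro mult_right_mono) auto
  moreover have "cosh t - 1 = 2 * (sinh u * sinh u)"
    using cosh_square_eq[of u] by (simp add: t_eq cosh_double power2_eq_square)
  moreover have "t * sinh t = 4 * (u * cosh u * sinh u)"
    by (simp add: t_eq sinh_double)
  ultimately show ?thesis by simp
qed simp

lemma cosh_minus_one_le:
  fixes t :: real
  assumes "0 < t"
  shows "(cosh t - 1) * (1 - t\<^sup>2 / 4) \<le> t\<^sup>2 / 2"
proof -
  define y where "y = cosh t - 1"
  have y_pos: "0 < y" using cosh_real_gt_1[of t] assms by (simp add: y_def)
  have "(2 * y)\<^sup>2 \<le> (t * sinh t)\<^sup>2"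
    using cosh_minus_one_le_sinh[of t] assms y_pos by (intro power_mono) (auto simp: y_def)
  also have "\<dots> = t\<^sup>2 * (y * (y + 2))"
    using cosh_square_eq[of t] by (simp add: y_def power2_eq_square algebra_simps)
  finally have "y * (4 * y) \<le> y * (t\<^sup>2 * (y + 2))"
    by (simp add: power2_eq_square algebra_simps)
  then have "4 * y \<le> t\<^sup>2 * (y + 2)" using y_pos by (simp only: mult_le_cancel_left_pos)
  then show ?thesis by (simp add: y_def[symmetric] algebra_simps)
qed

lemma geometric_cos_sums:
  fixes t :: real
  assumes "0 < t"
  shows "(\<lambda>N. exp (- t) ^ N * cos (real N * \<theta>)) sums ((1 + sinh t / (cosh t - cos \<theta>)) / 2)"
proof -
  define x where "x = exp (- t)"
  have x_bounds: "0 < x" "x < 1" using assms by (auto simp: x_def)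
  define z where "z = of_real x * cis \<theta>"
  have "(\<lambda>N. Re (z ^ N)) sums Re (1 / (1 - z))"
    using x_bounds by (intro sums_Re geometric_sums) (simp add: z_def norm_mult)
  moreover have "Re (z ^ N) = x ^ N * cos (real N * \<theta>)" for N
    by (simp add: z_def power_mult_distrib Complex.DeMoivre flip: of_real_power)
  moreover have "Re (1 / (1 - z)) = (1 + sinh t / (cosh t - cos \<theta>)) / 2"
  proof -
    have "1 < cosh t" using assms by (simp add: cosh_real_gt_1)
    then have denominator_pos: "0 < cosh t - cos \<theta>" using cos_le_one[of \<theta>] by linarith
    have "(1 - x * cos \<theta>)\<^sup>2 + (x * sin \<theta>)\<^sup>2 = 1 + x\<^sup>2 - 2 * x * cos \<theta>"
      using sin_cos_squared_add[of \<theta>] by algebra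
    also have "\<dots> = 2 * x * (cosh t - cos \<theta>)"
      using x_bounds by (simp add: cosh_field_def x_def power2_eq_square algebra_simps flip: exp_add)
    finally have "Re (1 / (1 - z)) = (1 - x * cos \<theta>) / (2 * x * (cosh t - cos \<theta>))"
      by (simp add: Re_divide z_def)
    also have "1 - x * cos \<theta> = x * (exp t - cos \<theta>)"
      by (simp add: x_def right_diff_distrib flip: exp_add)
    also have "exp t = sinh t + cosh t" by (rule sinh_plus_cosh[symmetric])
    also have "x * (sinh t + cosh t - cos \<theta>) / (2 * x * (cosh t - cos \<theta>))
        = (1 + sinh t / (cosh t - cos \<theta>)) / 2"
      using x_bounds denominator_pos by (simp add: field_simps)
    finally show ?thesis .
  qed
  ultimately show ?thesis by (simp add: x_def)
qed

context
  fixes t :: real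
  assumes t: "0 < t"
begin

private lemma summable_log_coeff_mult:
  assumes "\<And>N. \<bar>b N\<bar> \<le> C * real N ^ j"
  shows "summable (\<lambda>N. log_coeff N * exp (- t) ^ N * b N)"
    and "\<bar>\<Sum>N. log_coeff N * exp (- t) ^ N * b N\<bar> \<le> C * log_moment j t"
proof -
  have summable_majorant: "summable (\<lambda>N. C * (real N ^ j * log_coeff N * exp (- t) ^ N))"
    using summable_log_moment[OF t] by (rule summable_mult)
  have norm_le: "norm (log_coeff N * exp (- t) ^ N * b N)
      \<le> C * (real N ^ j * log_coeff N * exp (- t) ^ N)" for N
  proof -
    have "log_coeff N * exp (- t) ^ N * \<bar>b N\<bar> \<le> log_coeff N * exp (- t) ^ N * (C * real N ^ j)"
      using assms[of N] log_coeff_nonneg[of N] by (intro mult_left_mono) auto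
    then show ?thesis using log_coeff_nonneg[of N] by (simp add: abs_mult mult_ac)
  qed
  show "summable (\<lambda>N. log_coeff N * exp (- t) ^ N * b N)"
    using summable_majorant norm_le by (rule summable_comparison_test'[where N = 0])
  have "\<bar>\<Sum>N. log_coeff N * exp (- t) ^ N * b N\<bar> \<le> (\<Sum>N. C * (real N ^ j * log_coeff N * exp (- t) ^ N))"
    using norm_suminf_le[OF norm_le summable_majorant] by simp
  also have "\<dots> = C * log_moment j t"
    unfolding log_moment_def using summable_log_moment[OF t] by (rule suminf_mult)
  finally show "\<bar>\<Sum>N. log_coeff N * exp (- t) ^ N * b N\<bar> \<le> C * log_moment j t" .
qed

private lemma decay_term_bound: "\<bar>1 - cos (real N * \<theta>)\<bar> \<le> \<theta>\<^sup>2 / 2 * real N ^ 2"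
  using one_minus_cos_le[of "real N * \<theta>"] by (simp add: power_mult_distrib mult.commute)

private lemma phase_term_bound: "\<bar>sin (real N * \<theta>) - real N * \<theta>\<bar> \<le> \<bar>\<theta>\<bar> ^ 3 / 6 * real N ^ 3"
  using abs_sin_minus_self_le[of "real N * \<theta>"] by (simp add: abs_mult power_mult_distrib mult.commute)

lemma summable_decay: "summable (\<lambda>N. log_coeff N * exp (- t) ^ N * (1 - cos (real N * \<theta>)))"
  using decay_term_bound by (rule summable_log_coeff_mult)

lemma summable_phase: "summable (\<lambda>N. log_coeff N * exp (- t) ^ N * (sin (real N * \<theta>) - real N * \<theta>))"
  using phase_term_bound by (rule summable_log_coeff_mult)

lemma decay_le: "decay t \<theta> \<le> pi\<^sup>2 / 6 / t ^ 3 * \<theta>\<^sup>2"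
proof -
  have "\<bar>decay t \<theta>\<bar> \<le> \<theta>\<^sup>2 / 2 * log_moment 2 t"
    unfolding decay_def using decay_term_bound by (rule summable_log_coeff_mult)
  also have "\<dots> \<le> \<theta>\<^sup>2 / 2 * (pi\<^sup>2 / 6 * 2 / t ^ 3)"
    by (intro mult_left_mono log_moment_bounds t) auto
  finally show ?thesis by (simp add: mult_ac)
qed

lemma abs_phase_le: "\<bar>phase t \<theta>\<bar> \<le> 25 * pi\<^sup>2 / 144 * \<bar>\<theta>\<bar> ^ 3 / t ^ 4"
proof -
  have "\<bar>phase t \<theta>\<bar> \<le> \<bar>\<theta>\<bar> ^ 3 / 6 * log_moment 3 t"
    unfolding phase_def using phase_term_bound by (rule summable_log_coeff_mult)
  also have "\<dots> \<le> \<bar>\<theta>\<bar> ^ 3 / 6 * (pi\<^sup>2 / 6 * (25 / 4) / t ^ 4)"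
    by (intro mult_left_mono log_moment_bounds t) auto
  finally show ?thesis by (simp add: mult_ac)
qed

lemma log_gf_circle:
  "log_gf (of_real (exp (- t)) * cis \<theta>)
     = log_gf (of_real (exp (- t))) + \<i> * of_real (\<theta> * log_moment 1 t)
       + Complex (- decay t \<theta>) (phase t \<theta>)"
proof -
  define x where "x = exp (- t)"
  have x_bounds: "0 < x" "x < 1" using t by (auto simp: x_def)
  let ?c = "\<lambda>N. log_coeff N * x ^ N"
  have "(\<lambda>N. of_real (log_coeff N) * (of_real x * cis \<theta>) ^ N - of_real (log_coeff N) * of_real x ^ N
          - \<i> * of_real (\<theta> * (real N ^ 1 * log_coeff N * x ^ N)))
      sums (log_gf (of_real x * cis \<theta>) - log_gf (of_real x) - \<i> * of_real (\<theta> * log_moment 1 t))"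
    unfolding log_moment_def x_def
    by (intro sums_diff sums_mult log_gf_sums sums_of_real summable_sums summable_log_moment t)
       (use t in \<open>auto simp: norm_mult\<close>)
  moreover have "of_real (log_coeff N) * (of_real x * cis \<theta>) ^ N - of_real (log_coeff N) * of_real x ^ N
          - \<i> * of_real (\<theta> * (real N ^ 1 * log_coeff N * x ^ N))
      = Complex (- (?c N * (1 - cos (real N * \<theta>)))) (?c N * (sin (real N * \<theta>) - real N * \<theta>))" for N
    by (simp add: power_mult_distrib Complex.DeMoivre complex_eq_iff algebra_simps flip: of_real_power)
  moreover have "(\<lambda>N. Complex (- (?c N * (1 - cos (real N * \<theta>))))
        (?c N * (sin (real N * \<theta>) - real N * \<theta>)))
      sums Complex (- decay t \<theta>) (phase t \<theta>)"
    unfolding decay_def phase_def x_def using summable_decay summable_phase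
    by (auto simp: sums_complex_iff intro!: sums_minus summable_sums)
  ultimately have "log_gf (of_real x * cis \<theta>) - log_gf (of_real x) - \<i> * of_real (\<theta> * log_moment 1 t)
      = Complex (- decay t \<theta>) (phase t \<theta>)"
    using sums_unique2 by (simp only:) blast
  then show ?thesis unfolding x_def by (simp add: algebra_simps)
qed

text \<open>Only the part \<open>1 \<le> \<sigma>(N)/N\<close> of the coefficients is used, which makes the series geometric.\<close>
lemma decay_ge_geometric:
  "sinh t / (2 * (cosh t - 1)) * ((1 - cos \<theta>) / (cosh t - cos \<theta>)) \<le> decay t \<theta>"
proof -
  define A B where "A = cosh t - 1" and "B = cosh t - cos \<theta>"
  have "0 < A" using t by (simp add: A_def cosh_real_gt_1)
  moreover have "A \<le> B" by (simp add: A_def B_def)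
  ultimately have AB_pos: "0 < A" "0 < B" by linarith+
  have "(1 + sinh t / A) / 2 - (1 + sinh t / B) / 2 = sinh t / (2 * A) * ((B - A) / B)"
    using AB_pos by (simp add: field_simps)
  then have closed_form: "(1 + sinh t / (cosh t - cos 0)) / 2 - (1 + sinh t / (cosh t - cos \<theta>)) / 2
      = sinh t / (2 * (cosh t - 1)) * ((1 - cos \<theta>) / (cosh t - cos \<theta>))"
    by (simp add: A_def B_def)
  have "(\<lambda>N. exp (- t) ^ N * cos (real N * 0) - exp (- t) ^ N * cos (real N * \<theta>)) sums
      ((1 + sinh t / (cosh t - cos 0)) / 2 - (1 + sinh t / (cosh t - cos \<theta>)) / 2)"
    by (intro sums_diff geometric_cos_sums t)
  then have geometric: "(\<lambda>N. 1 * exp (- t) ^ N * (1 - cos (real N * \<theta>))) sums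
      (sinh t / (2 * (cosh t - 1)) * ((1 - cos \<theta>) / (cosh t - cos \<theta>)))"
    unfolding closed_form by (simp add: right_diff_distrib)
  have "1 * exp (- t) ^ N * (1 - cos (real N * \<theta>))
      \<le> log_coeff N * exp (- t) ^ N * (1 - cos (real N * \<theta>))" for N
    using mult_right_mono[OF log_coeff_ge_1[of N], of "exp (- t) ^ N * (1 - cos (real N * \<theta>))"]
    by (cases "N = 0") (simp_all add: mult.assoc)
  then show ?thesis
    unfolding decay_def using geometric summable_sums[OF summable_decay] by (rule sums_le)
qed

lemma decay_ge_of_ratio:
  assumes "0 \<le> s" "s * (cosh t - 1) \<le> 1 - cos \<theta>"
  shows "s / (1 + s) / t \<le> decay t \<theta>"
proof -
  have cosh_gt_1: "0 < cosh t - 1" using t by (simp add: cosh_real_gt_1)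
  have "1 / t \<le> sinh t / (2 * (cosh t - 1))"
    using cosh_minus_one_le_sinh[of t] t cosh_gt_1 by (simp add: field_simps)
  moreover have "s / (1 + s) \<le> (1 - cos \<theta>) / (cosh t - cos \<theta>)"
  proof -
    have "0 \<le> 1 - cos \<theta>" by simp
    then have denominator_pos: "0 < cosh t - cos \<theta>" using cosh_gt_1 by linarith
    have "s * (cosh t - cos \<theta>) \<le> (1 - cos \<theta>) * (1 + s)"
      using assms(2) by (simp add: algebra_simps)
    then show ?thesis
      using assms(1) denominator_pos by (simp add: pos_divide_le_eq pos_le_divide_eq)
  qed
  ultimately have "1 / t * (s / (1 + s))
      \<le> sinh t / (2 * (cosh t - 1)) * ((1 - cos \<theta>) / (cosh t - cos \<theta>))"
    using assms t cosh_gt_1 by (intro mult_mono) auto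
  also have "\<dots> \<le> decay t \<theta>" by (rule decay_ge_geometric)
  finally show ?thesis by (simp add: mult.commute)
qed

end

locale small_saddle =
  fixes t :: real
  assumes t_pos: "0 < t" and t_le: "t \<le> 1 / 22"
begin

lemma t_less_pi: "4 * t < pi"
  using t_le pi_gt3 by simp

lemma one_minus_cos_ge_cosh_minus_one:
  assumes a_bounds: "0 \<le> a" "a \<le> 4" and \<theta>_bounds: "a * t \<le> \<bar>\<theta>\<bar>" "\<bar>\<theta>\<bar> \<le> pi"
  shows "99 / 100 * a\<^sup>2 * (cosh t - 1) \<le> 1 - cos \<theta>"
proof -
  have at_bounds: "0 \<le> a * t" "a * t \<le> 4 * (1 / 22)"
    using a_bounds t_pos t_le mult_mono[of a 4 t "1 / 22"] by auto
  have "t\<^sup>2 \<le> (1 / 22)\<^sup>2" using t_pos t_le by (intro power_mono) auto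
  then have "(cosh t - 1) * (999 / 1000) \<le> (cosh t - 1) * (1 - t\<^sup>2 / 4)"
    by (intro mult_left_mono) (auto simp: power2_eq_square cosh_real_ge_1)
  also have "\<dots> \<le> t\<^sup>2 / 2" by (rule cosh_minus_one_le[OF t_pos])
  finally have "cosh t - 1 \<le> 1000 / 999 * (t\<^sup>2 / 2)" by simp
  then have "99 / 100 * a\<^sup>2 * (cosh t - 1) \<le> 99 / 100 * a\<^sup>2 * (1000 / 999 * (t\<^sup>2 / 2))"
    by (intro mult_left_mono) auto
  also have "\<dots> \<le> (a * t)\<^sup>2 / 2 * (997 / 1000)"
    by (simp add: power_mult_distrib)
  also have "\<dots> \<le> (a * t)\<^sup>2 / 2 * (1 - (a * t)\<^sup>2 / 12)"
  proof -
    have "(a * t)\<^sup>2 \<le> (4 * (1 / 22))\<^sup>2" using at_bounds by (intro power_mono) auto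
    also have "\<dots> \<le> 36 / 1000" by (simp add: power2_eq_square)
    finally show ?thesis by (intro mult_left_mono) auto
  qed
  also have "\<dots> \<le> 1 - cos (a * t)"
    using at_bounds by (intro one_minus_cos_ge) auto
  also have "\<dots> \<le> 1 - cos \<bar>\<theta>\<bar>"
    using at_bounds \<theta>_bounds by (intro diff_left_mono cos_monotone_0_pi_le) auto
  finally show ?thesis by simp
qed

lemma decay_ge:
  assumes "0 \<le> a" "a \<le> 4" "a * t \<le> \<bar>\<theta>\<bar>" "\<bar>\<theta>\<bar> \<le> pi"
  shows "99 / 100 * a\<^sup>2 / (1 + 99 / 100 * a\<^sup>2) / t \<le> decay t \<theta>"
  using one_minus_cos_ge_cosh_minus_one[OF assms] by (intro decay_ge_of_ratio t_pos) auto

definition upper_gaussian :: "real \<Rightarrow> real" where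
  "upper_gaussian \<theta> = exp (- (pi / 4 / t ^ 3 * \<theta>\<^sup>2))"

definition lower_gaussian :: "real \<Rightarrow> real" where
  "lower_gaussian \<theta> = exp (- (pi\<^sup>2 / 6 / t ^ 3 * \<theta>\<^sup>2))"

lemma lower_gaussian_le_exp_decay: "lower_gaussian \<theta> \<le> exp (- decay t \<theta>)"
  using decay_le[OF t_pos, of \<theta>] by (simp add: lower_gaussian_def)

lemma exp_decay_le_upper_gaussian:
  assumes "\<bar>\<theta>\<bar> \<le> t / 2"
  shows "exp (- decay t \<theta>) \<le> upper_gaussian \<theta>"
proof -
  define a where "a = \<bar>\<theta>\<bar> / t"
  have a_bounds: "0 \<le> a" "a \<le> 1 / 2" "a * t = \<bar>\<theta>\<bar>"
    using assms t_pos by (auto simp: a_def field_simps)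
  have "a\<^sup>2 \<le> (1 / 2)\<^sup>2" using a_bounds by (intro power_mono) auto
  then have "pi / 4 * (1 + 99 / 100 * a\<^sup>2) \<le> (315 / 100) / 4 * (1 + 99 / 100 * (1 / 2)\<^sup>2)"
    using pi_approx by (intro mult_mono) auto
  also have "\<dots> \<le> 99 / 100" by (simp add: power2_eq_square)
  finally have "pi / 4 * (1 + 99 / 100 * a\<^sup>2) * a\<^sup>2 \<le> 99 / 100 * a\<^sup>2"
    by (intro mult_right_mono) auto
  then have "pi / 4 * a\<^sup>2 \<le> 99 / 100 * a\<^sup>2 / (1 + 99 / 100 * a\<^sup>2)"
    by (subst pos_le_divide_eq) (auto simp: mult_ac add_pos_nonneg)
  then have "pi / 4 * a\<^sup>2 / t \<le> 99 / 100 * a\<^sup>2 / (1 + 99 / 100 * a\<^sup>2) / t"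
    using t_pos by (intro divide_right_mono) auto
  also have "\<dots> \<le> decay t \<theta>"
    using a_bounds assms t_less_pi t_pos by (intro decay_ge) auto
  also have "pi / 4 * a\<^sup>2 / t = pi / 4 / t ^ 3 * \<theta>\<^sup>2"
    using t_pos by (simp add: a_def power_divide power2_eq_square power3_eq_cube)
  finally show ?thesis by (simp add: upper_gaussian_def)
qed

text \<open>The exponents come from the lower bound for the decay at \<open>|\<theta>| = t/2\<close>, \<open>t\<close> and \<open>4t\<close>.\<close>
definition arc_bound :: "real \<Rightarrow> real" where
  "arc_bound \<theta> = (if \<theta> \<in> {-t..t} then exp (- (198 / 1000 / t)) else 0)
     + (if \<theta> \<in> {-(4 * t)..4 * t} then exp (- (497 / 1000 / t)) else 0) + exp (- (93 / 100 / t))"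

lemma arc_bound_nonneg: "0 \<le> arc_bound \<theta>"
  by (simp add: arc_bound_def)

lemma exp_decay_le_arc_bound:
  assumes "t / 2 \<le> \<bar>\<theta>\<bar>" "\<bar>\<theta>\<bar> \<le> pi"
  shows "exp (- decay t \<theta>) \<le> arc_bound \<theta>"
proof -
  have exp_decay_le_at: "exp (- decay t \<theta>) \<le> exp (- (q / t))"
    if "0 \<le> a" "a \<le> 4" "a * t \<le> \<bar>\<theta>\<bar>" "q \<le> 99 / 100 * a\<^sup>2 / (1 + 99 / 100 * a\<^sup>2)" for a q
  proof -
    have "q / t \<le> 99 / 100 * a\<^sup>2 / (1 + 99 / 100 * a\<^sup>2) / t"
      using that t_pos by (intro divide_right_mono) auto
    also have "\<dots> \<le> decay t \<theta>" using that assms by (intro decay_ge) auto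
    finally show ?thesis by simp
  qed
  consider (near) "\<bar>\<theta>\<bar> \<le> t" | (middle) "t \<le> \<bar>\<theta>\<bar>" "\<bar>\<theta>\<bar> \<le> 4 * t" | (far) "4 * t \<le> \<bar>\<theta>\<bar>" by linarith
  then show ?thesis
  proof cases
    case near
    have "exp (- decay t \<theta>) \<le> exp (- (198 / 1000 / t))"
      using assms by (intro exp_decay_le_at[of "1 / 2"]) (auto simp: power2_eq_square)
    then show ?thesis using near by (auto simp: arc_bound_def abs_le_iff add_increasing2)
  next
    case middle
    have "exp (- decay t \<theta>) \<le> exp (- (497 / 1000 / t))"
      using middle by (intro exp_decay_le_at[of 1]) auto
    then show ?thesis
      using middle by (auto simp: arc_bound_def abs_le_iff add_increasing add_increasing2)
  next
    case far
    have "exp (- decay t \<theta>) \<le> exp (- (93 / 100 / t))"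
      using far by (intro exp_decay_le_at[of 4]) auto
    then show ?thesis by (auto simp: arc_bound_def add_increasing)
  qed
qed

lemma exp_decay_le:
  assumes "\<bar>\<theta>\<bar> \<le> pi"
  shows "exp (- decay t \<theta>) \<le> upper_gaussian \<theta> + arc_bound \<theta>"
proof (cases "\<bar>\<theta>\<bar> \<le> t / 2")
  case True
  then show ?thesis
    using exp_decay_le_upper_gaussian[of \<theta>] arc_bound_nonneg[of \<theta>] by (intro add_increasing2) auto
next
  case False
  then show ?thesis
    using exp_decay_le_arc_bound[of \<theta>] assms by (intro add_increasing) (auto simp: upper_gaussian_def)
qed

lemma one_le_sixteen_quartic:
  assumes "t / 2 \<le> \<bar>\<theta>\<bar>"
  shows "1 \<le> 16 / t ^ 4 * \<theta> ^ 4"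
proof -
  have "(t / 2) ^ 4 \<le> \<bar>\<theta>\<bar> ^ 4" using assms t_pos by (intro power_mono) auto
  then show ?thesis using t_pos by (simp add: power_divide field_simps)
qed

definition phase_constant :: real where
  "phase_constant = 625 * pi ^ 4 / 41472 / t ^ 8"

lemma half_phase_square_le: "(phase t \<theta>)\<^sup>2 / 2 \<le> phase_constant * \<theta> ^ 6"
proof -
  have "(phase t \<theta>)\<^sup>2 \<le> (25 * pi\<^sup>2 / 144 * \<bar>\<theta>\<bar> ^ 3 / t ^ 4)\<^sup>2"
    using abs_phase_le[OF t_pos, of \<theta>] t_pos by (intro power2_le_iff_abs_le[THEN iffD2]) auto
  also have "\<dots> = 2 * phase_constant * \<theta> ^ 6"
    by (simp add: phase_constant_def power_mult_distrib power_divide flip: power_mult)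
  finally show ?thesis by simp
qed

text \<open>The factor \<open>1 - 16 \<theta>^4/t^4\<close> is nonpositive for \<open>|\<theta>| \<ge> t/2\<close>; it allows the integral to be
  extended to the whole line.\<close>
lemma exp_decay_cos_phase_ge:
  assumes "\<bar>\<theta>\<bar> \<le> pi"
  shows "lower_gaussian \<theta> * (1 - 16 / t ^ 4 * \<theta> ^ 4)
           - phase_constant * \<theta> ^ 6 * upper_gaussian \<theta> - arc_bound \<theta>
    \<le> exp (- decay t \<theta>) * cos (phase t \<theta>)"
    (is "?main - ?error - _ \<le> _")
proof (cases "\<bar>\<theta>\<bar> \<le> t / 2")
  case True
  have "?main \<le> lower_gaussian \<theta> * 1"
    using t_pos by (intro mult_left_mono) (auto simp: lower_gaussian_def)
  also have "\<dots> \<le> exp (- decay t \<theta>)"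
    using lower_gaussian_le_exp_decay by simp
  finally have "?main \<le> exp (- decay t \<theta>)" .
  moreover have "exp (- decay t \<theta>) * (1 - cos (phase t \<theta>)) \<le> ?error"
  proof -
    have "1 - cos (phase t \<theta>) \<le> phase_constant * \<theta> ^ 6"
      using one_minus_cos_le half_phase_square_le by (rule order_trans)
    then show ?thesis
      using exp_decay_le_upper_gaussian[OF True] t_pos
      by (subst mult.commute) (intro mult_mono, auto simp: phase_constant_def)
  qed
  ultimately show ?thesis using arc_bound_nonneg[of \<theta>] by (simp add: right_diff_distrib)
next
  case False
  have "?main \<le> 0"
    using one_le_sixteen_quartic[of \<theta>] False
    by (intro mult_nonneg_nonpos) (auto simp: lower_gaussian_def)
  moreover have "0 \<le> ?error"
    using t_pos by (simp add: phase_constant_def upper_gaussian_def)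
  moreover have "- arc_bound \<theta> \<le> exp (- decay t \<theta>) * cos (phase t \<theta>)"
  proof -
    have "- exp (- decay t \<theta>) \<le> exp (- decay t \<theta>) * cos (phase t \<theta>)"
      using mult_left_mono[OF cos_ge_minus_one[of "phase t \<theta>"], of "exp (- decay t \<theta>)"] by simp
    then show ?thesis using exp_decay_le_arc_bound[of \<theta>] assms False by linarith
  qed
  ultimately show ?thesis by linarith
qed

end

section \<open>Integral estimates\<close>

lemma has_integral_gaussian_moment:
  fixes a :: real
  assumes "0 < a"
  shows "((\<lambda>x. x ^ (2 * k) * exp (- (a * x\<^sup>2))) has_integral
           (sqrt (pi / a) * (fact (2 * k) / ((4 * a) ^ k * fact k)))) UNIV"
proof -
  define \<sigma> where "\<sigma> = sqrt (1 / (2 * a))"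
  have \<sigma>_pos: "0 < \<sigma>" and \<sigma>_square: "\<sigma>\<^sup>2 = 1 / (2 * a)" using assms by (auto simp: \<sigma>_def)
  have "((\<lambda>x. normal_density 0 \<sigma> x * (x - 0) ^ (2 * k)) has_integral
      (fact (2 * k) / ((2 / \<sigma>\<^sup>2) ^ k * fact k))) UNIV"
    using has_integral_integral_lborel[OF integrable.intros[OF normal_moment_even[OF \<sigma>_pos, of 0 k]]]
    unfolding integral_normal_moment_even[OF \<sigma>_pos] .
  then have "((\<lambda>x. sqrt (pi / a) * (normal_density 0 \<sigma> x * (x - 0) ^ (2 * k))) has_integral
      (sqrt (pi / a) * (fact (2 * k) / ((2 / \<sigma>\<^sup>2) ^ k * fact k)))) UNIV"
    by (rule has_integral_mult_right)
  moreover have "sqrt (pi / a) * (normal_density 0 \<sigma> x * (x - 0) ^ (2 * k))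
      = x ^ (2 * k) * exp (- (a * x\<^sup>2))" for x
  proof -
    have "2 * pi * \<sigma>\<^sup>2 = pi / a" "2 * \<sigma>\<^sup>2 = 1 / a" using assms by (auto simp: \<sigma>_square)
    then have "normal_density 0 \<sigma> x = 1 / sqrt (pi / a) * exp (- (a * x\<^sup>2))"
      by (simp only: normal_density_def) (simp add: mult.commute)
    then show ?thesis using assms by simp
  qed
  moreover have "2 / \<sigma>\<^sup>2 = 4 * a" using assms by (simp add: \<sigma>_square)
  ultimately show ?thesis by (simp only:)
qed

lemma has_integral_even_power:
  fixes s :: real
  assumes "0 \<le> s"
  shows "((\<lambda>x. x ^ (2 * k)) has_integral (2 * s ^ (2 * k + 1) / real (2 * k + 1))) {-s..s}"
proof -
  have "((\<lambda>x. x ^ (2 * k)) has_integral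
      (s ^ (2 * k + 1) / real (2 * k + 1) - (- s) ^ (2 * k + 1) / real (2 * k + 1))) {-s..s}"
  proof (rule fundamental_theorem_of_calculus)
    fix x :: real
    have "((\<lambda>x. x ^ (2 * k + 1) / real (2 * k + 1)) has_real_derivative x ^ (2 * k))
        (at x within {-s..s})"
      using DERIV_cdivide[OF DERIV_pow[of "2 * k + 1" x "{-s..s}"], of "real (2 * k + 1)"]
      by (simp del: of_nat_add of_nat_mult)
    then show "((\<lambda>x. x ^ (2 * k + 1) / real (2 * k + 1)) has_vector_derivative x ^ (2 * k))
        (at x within {-s..s})"
      by (simp only: has_real_derivative_iff_has_vector_derivative)
  qed (use assms in simp)
  then show ?thesis by simp
qed

lemma exp_neg_div_le_power:
  fixes t \<tau> :: real
  assumes "0 < t" "t \<le> \<tau>" "real j \<le> a / \<tau>"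
  shows "exp (- (a / t)) \<le> exp (- (a / \<tau>)) * (t / \<tau>) ^ j"
proof -
  have \<tau>_pos: "0 < \<tau>" using assms by simp
  have "ln (\<tau> / t) \<le> \<tau> / t - 1" using assms \<tau>_pos by (intro ln_le_minus_one) auto
  then have "real j * ln (\<tau> / t) \<le> real j * (\<tau> / t - 1)" by (intro mult_left_mono) auto
  also have "\<dots> \<le> a / \<tau> * (\<tau> / t - 1)" using assms \<tau>_pos by (intro mult_right_mono) auto
  also have "\<dots> = a / t - a / \<tau>" using assms \<tau>_pos by (simp add: field_simps)
  finally have "- (a / t) \<le> - (a / \<tau>) + real j * ln (t / \<tau>)"
    using assms \<tau>_pos by (simp add: ln_div algebra_simps)
  then have "exp (- (a / t)) \<le> exp (- (a / \<tau>) + real j * ln (t / \<tau>))" by simp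
  also have "\<dots> = exp (- (a / \<tau>)) * (t / \<tau>) ^ j"
    using assms \<tau>_pos by (simp only: exp_add exp_of_nat_mult) simp
  finally show ?thesis .
qed

lemma le_exp_divide:
  assumes "0 < q" "x ^ q \<le> (27 / 10) ^ p"
  shows "x \<le> exp (real p / real q)"
proof -
  have "27 / 10 \<le> exp (1 :: real)"
    using e_approx_32 by (simp add: abs_if split: if_splits)
  then have "(27 / 10) ^ p \<le> exp (1 :: real) ^ p" by (intro power_mono) auto
  also have "\<dots> = exp (real p / real q) ^ q"
    using assms(1) by (simp flip: exp_of_nat_mult)
  finally have "x ^ q \<le> exp (real p / real q) ^ q"
    using assms(2) by (rule order_trans[rotated])
  then show ?thesis
    using assms(1) power_le_imp_le_base[of x "q - 1" "exp (real p / real q)"] by simp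
qed

context small_saddle
begin

lemma exp_neg_div_le:
  assumes "0 < c" "real j \<le> 22 * a" "0 < q"
    and "(22 ^ j / c) ^ q \<le> (27 / 10) ^ p" "real p \<le> 22 * a * real q"
  shows "exp (- (a / t)) \<le> c * t ^ j"
proof -
  have "22 ^ j / c \<le> exp (real p / real q)"
    using assms(3,4) by (rule le_exp_divide)
  also have "\<dots> \<le> exp (22 * a)"
    using assms(3,5) by (simp add: field_simps)
  finally have c_ge: "22 ^ j / exp (22 * a) \<le> c"
    using assms(1) by (simp add: field_simps)
  have "exp (- (a / t)) \<le> exp (- (a / (1 / 22))) * (t / (1 / 22)) ^ j"
    using t_pos t_le assms(2) by (intro exp_neg_div_le_power) auto
  also have "\<dots> = 22 ^ j / exp (22 * a) * t ^ j"
    by (simp add: power_mult_distrib exp_minus field_simps)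
  also have "\<dots> \<le> c * t ^ j"
    using c_ge t_pos by (intro mult_right_mono) auto
  finally show ?thesis .
qed

lemma exp_arc_bounds:
  shows "exp (- (198 / 1000 / t)) \<le> 144 * t ^ 3"
    and "exp (- (497 / 1000 / t)) \<le> 1 / 4 * t ^ 3"
    and "exp (- (93 / 100 / t)) \<le> 1 / 5 * t ^ 6"
  using exp_neg_div_le[of 144 3 "198 / 1000" 3 13] exp_neg_div_le[of "1 / 4" 3 "497 / 1000" 5 54]
    exp_neg_div_le[of "1 / 5" 6 "93 / 100" 3 61]
  by (simp_all add: power_divide)

definition width :: real where
  "width = sqrt (t ^ 3)"

lemma width_pos: "0 < width"
  using t_pos by (simp add: width_def)

lemma width_square: "width\<^sup>2 = t ^ 3"
  using t_pos by (simp add: width_def)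

lemma width_le: "width \<le> 97 / 10000"
proof (rule power2_le_imp_le)
  have "width\<^sup>2 \<le> (1 / 22) ^ 3"
    unfolding width_square using t_pos t_le by (intro power_mono) auto
  also have "\<dots> \<le> (97 / 10000)\<^sup>2" by (simp add: power_divide)
  finally show "width\<^sup>2 \<le> (97 / 10000)\<^sup>2" .
qed simp

definition gaussian_moment :: "nat \<Rightarrow> real" where
  "gaussian_moment k = 2 * width * (fact (2 * k) / fact k * (width\<^sup>2 / pi) ^ k)"

definition arc_moment :: "nat \<Rightarrow> real" where
  "arc_moment k = 2 / real (2 * k + 1) * (t ^ (2 * k + 1) * exp (- (198 / 1000 / t))
     + (4 * t) ^ (2 * k + 1) * exp (- (497 / 1000 / t)) + pi ^ (2 * k + 1) * exp (- (93 / 100 / t)))"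

lemma has_integral_gaussian:
  "((\<lambda>\<theta>. \<theta> ^ (2 * k) * upper_gaussian \<theta>) has_integral gaussian_moment k) UNIV"
proof -
  have "sqrt (pi / (pi / 4 / t ^ 3)) = sqrt (4 * t ^ 3)"
    by simp
  also have "\<dots> = 2 * width"
    by (simp only: width_def real_sqrt_mult real_sqrt_four)
  finally have "sqrt (pi / (pi / 4 / t ^ 3)) * (fact (2 * k) / ((4 * (pi / 4 / t ^ 3)) ^ k * fact k))
      = gaussian_moment k"
    using t_pos by (simp add: gaussian_moment_def width_square power_divide field_simps)
  then show ?thesis
    using has_integral_gaussian_moment[of "pi / 4 / t ^ 3" k] t_pos by (simp add: upper_gaussian_def)
qed

lemma has_integral_arc_bound:
  "((\<lambda>\<theta>. \<theta> ^ (2 * k) * arc_bound \<theta>) has_integral arc_moment k) {-pi..pi}"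
proof -
  have power: "((\<lambda>\<theta>. \<theta> ^ (2 * k) * c) has_integral (2 * s ^ (2 * k + 1) / real (2 * k + 1) * c)) {-s..s}"
    if "0 \<le> s" for s c :: real
    using has_integral_even_power[OF that] by (rule has_integral_mult_left)
  have restrict: "((\<lambda>\<theta>. if \<theta> \<in> {-s..s} then \<theta> ^ (2 * k) * c else 0) has_integral
      (2 * s ^ (2 * k + 1) / real (2 * k + 1) * c)) {-pi..pi}" if "0 \<le> s" "s \<le> pi" for s c :: real
    using power[OF that(1)] that(2) by (subst has_integral_restrict) auto
  have "((\<lambda>\<theta>. (if \<theta> \<in> {-t..t} then \<theta> ^ (2 * k) * exp (- (198 / 1000 / t)) else 0)
     + (if \<theta> \<in> {-(4 * t)..4 * t} then \<theta> ^ (2 * k) * exp (- (497 / 1000 / t)) else 0)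
     + \<theta> ^ (2 * k) * exp (- (93 / 100 / t))) has_integral
     (2 * t ^ (2 * k + 1) / real (2 * k + 1) * exp (- (198 / 1000 / t))
       + 2 * (4 * t) ^ (2 * k + 1) / real (2 * k + 1) * exp (- (497 / 1000 / t))
       + 2 * pi ^ (2 * k + 1) / real (2 * k + 1) * exp (- (93 / 100 / t)))) {-pi..pi}"
    using t_pos t_less_pi by (intro has_integral_add restrict power) auto
  also have "(\<lambda>\<theta>. (if \<theta> \<in> {-t..t} then \<theta> ^ (2 * k) * exp (- (198 / 1000 / t)) else 0)
     + (if \<theta> \<in> {-(4 * t)..4 * t} then \<theta> ^ (2 * k) * exp (- (497 / 1000 / t)) else 0)
     + \<theta> ^ (2 * k) * exp (- (93 / 100 / t))) = (\<lambda>\<theta>. \<theta> ^ (2 * k) * arc_bound \<theta>)"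
    by (auto simp: arc_bound_def distrib_left)
  finally show ?thesis
    by (simp only: arc_moment_def distrib_left times_divide_eq_left mult.assoc)
qed

lemma integral_le_moments:
  assumes "(f has_integral I) {-pi..pi}"
    and "\<And>\<theta>. \<bar>\<theta>\<bar> \<le> pi \<Longrightarrow> f \<theta> \<le> \<theta> ^ (2 * k) * exp (- decay t \<theta>)"
  shows "I \<le> gaussian_moment k + arc_moment k"
proof (rule has_integral_le)
  show "((\<lambda>\<theta>. if \<theta> \<in> {-pi..pi} then f \<theta> else 0) has_integral I) UNIV"
    using assms(1) by (rule has_integral_restrict_UNIV[THEN iffD2])
  show "((\<lambda>\<theta>. \<theta> ^ (2 * k) * upper_gaussian \<theta>
      + (if \<theta> \<in> {-pi..pi} then \<theta> ^ (2 * k) * arc_bound \<theta> else 0)) has_integral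
      (gaussian_moment k + arc_moment k)) UNIV"
    by (intro has_integral_add has_integral_gaussian has_integral_restrict_UNIV[THEN iffD2]
        has_integral_arc_bound)
  fix \<theta> :: real
  have nonneg: "0 \<le> \<theta> ^ (2 * k)" by (simp add: zero_le_even_power)
  show "(if \<theta> \<in> {-pi..pi} then f \<theta> else 0) \<le> \<theta> ^ (2 * k) * upper_gaussian \<theta>
      + (if \<theta> \<in> {-pi..pi} then \<theta> ^ (2 * k) * arc_bound \<theta> else 0)"
  proof (cases "\<bar>\<theta>\<bar> \<le> pi")
    case True
    then have "f \<theta> \<le> \<theta> ^ (2 * k) * exp (- decay t \<theta>)" by (rule assms(2))
    also have "\<dots> \<le> \<theta> ^ (2 * k) * (upper_gaussian \<theta> + arc_bound \<theta>)"
      using exp_decay_le[OF True] nonneg by (rule mult_left_mono)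
    finally show ?thesis using True by (auto simp: distrib_left)
  qed (use nonneg in \<open>auto simp: upper_gaussian_def\<close>)
qed

lemma arc_moment_0_le: "arc_moment 0 \<le> 128 / 1000 * width"
proof -
  have "arc_moment 0 = 2 * (t * exp (- (198 / 1000 / t)) + 4 * t * exp (- (497 / 1000 / t))
      + pi * exp (- (93 / 100 / t)))"
    by (simp add: arc_moment_def)
  also have "\<dots> \<le> 2 * (t * (144 * t ^ 3) + 4 * t * (1 / 4 * t ^ 3) + 4 * (1 / 5 * t ^ 6))"
    using t_pos pi_less_4 by (intro mult_left_mono[of _ _ 2] add_mono mult_mono exp_arc_bounds) auto
  also have "\<dots> = 2 * width\<^sup>2 * (145 * t + 4 / 5 * width\<^sup>2)"
    unfolding width_square by (simp add: algebra_simps flip: power_add)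
  also have "\<dots> \<le> 2 * width\<^sup>2 * (145 * (1 / 22) + 4 / 5 * (97 / 10000)\<^sup>2)"
    using t_le width_le width_pos by (intro mult_left_mono add_mono power_mono) auto
  also have "\<dots> \<le> 2 * width\<^sup>2 * (6591 / 1000)"
    by (intro mult_left_mono) (auto simp: power2_eq_square)
  also have "\<dots> = 6591 / 500 * width * width" by (simp add: power2_eq_square)
  also have "\<dots> \<le> 6591 / 500 * width * (97 / 10000)"
    using width_le width_pos by (intro mult_left_mono) auto
  finally show ?thesis using width_pos by simp
qed

lemma arc_moment_1_le: "arc_moment 1 \<le> 108 / 100 * width ^ 3"
proof -
  have pi_cube_le: "pi ^ 3 \<le> 32"
    using power_mono[of pi "315 / 100" 3] pi_approx by (simp add: power3_eq_cube)
  have "arc_moment 1 = 2 / 3 * (t ^ 3 * exp (- (198 / 1000 / t)) + 64 * t ^ 3 * exp (- (497 / 1000 / t))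
      + pi ^ 3 * exp (- (93 / 100 / t)))"
    by (simp add: arc_moment_def power_mult_distrib eval_nat_numeral)
  also have "\<dots> \<le> 2 / 3 * (t ^ 3 * (144 * t ^ 3) + 64 * t ^ 3 * (1 / 4 * t ^ 3) + 32 * (1 / 5 * t ^ 6))"
    using t_pos pi_cube_le
    by (intro mult_left_mono[of _ _ "2 / 3"] add_mono mult_mono exp_arc_bounds) auto
  also have "\<dots> = 2 / 3 * (832 / 5) * width ^ 3 * width"
    using arg_cong[OF width_square, of "\<lambda>x. x\<^sup>2"] by (simp flip: power_mult power_add power_Suc2)
  also have "\<dots> \<le> 2 / 3 * (832 / 5) * width ^ 3 * (97 / 10000)"
    using width_le width_pos by (intro mult_left_mono) auto
  also have "\<dots> \<le> 108 / 100 * width ^ 3" using width_pos by simp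
  finally show ?thesis .
qed

lemma integral_exp_decay_le:
  assumes "((\<lambda>\<theta>. exp (- decay t \<theta>)) has_integral I) {-pi..pi}"
  shows "I \<le> 213 / 100 * width"
proof -
  have "I \<le> gaussian_moment 0 + arc_moment 0"
    using assms by (rule integral_le_moments) simp
  moreover have "gaussian_moment 0 = 2 * width" by (simp add: gaussian_moment_def)
  ultimately show ?thesis using arc_moment_0_le width_pos by linarith
qed

lemma integral_exp_decay_cos_le:
  assumes "((\<lambda>\<theta>. exp (- decay t \<theta>) * (1 - cos \<theta>)) has_integral J) {-pi..pi}"
  shows "J \<le> 118 / 100 * width ^ 3"
proof -
  have "2 * J \<le> gaussian_moment 1 + arc_moment 1"
  proof (rule integral_le_moments)
    show "((\<lambda>\<theta>. 2 * (exp (- decay t \<theta>) * (1 - cos \<theta>))) has_integral (2 * J)) {-pi..pi}"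
      using assms by (rule has_integral_mult_right)
    fix \<theta> :: real
    have "exp (- decay t \<theta>) * (1 - cos \<theta>) \<le> exp (- decay t \<theta>) * (\<theta>\<^sup>2 / 2)"
      by (intro mult_left_mono one_minus_cos_le) simp
    then show "2 * (exp (- decay t \<theta>) * (1 - cos \<theta>)) \<le> \<theta> ^ (2 * 1) * exp (- decay t \<theta>)"
      by (simp add: mult_ac)
  qed
  moreover have "gaussian_moment 1 = 4 / pi * width ^ 3"
    by (simp add: gaussian_moment_def power2_eq_square power3_eq_cube)
  moreover have "4 / pi * width ^ 3 \<le> 128 / 100 * width ^ 3"
    using width_pos pi_approx by (intro mult_right_mono) (auto simp: field_simps)
  ultimately show ?thesis using arc_moment_1_le by linarith
qed

definition main_term :: real where
  "main_term = sqrt (6 / pi) * width * (1 - 432 / pi ^ 4 * t\<^sup>2)"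

lemma has_integral_main_term:
  "((\<lambda>\<theta>. lower_gaussian \<theta> * (1 - 16 / t ^ 4 * \<theta> ^ 4)) has_integral main_term) UNIV"
proof -
  define a where "a = pi\<^sup>2 / 6 / t ^ 3"
  define S where "S = sqrt (6 / pi) * width"
  have a_pos: "0 < a" using t_pos by (simp add: a_def)
  have "pi / a = 6 / pi * t ^ 3"
    by (simp add: a_def power2_eq_square)
  then have sqrt_eq: "sqrt (pi / a) = S"
    by (simp only: S_def width_def real_sqrt_mult)
  have moment: "((\<lambda>\<theta>. \<theta> ^ (2 * k) * exp (- (a * \<theta>\<^sup>2))) has_integral
      (S * (fact (2 * k) / ((4 * a) ^ k * fact k)))) UNIV" for k
    using has_integral_gaussian_moment[OF a_pos, of k] by (simp only: sqrt_eq)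
  have "((\<lambda>\<theta>. \<theta> ^ (2 * 0) * exp (- (a * \<theta>\<^sup>2)) - 16 / t ^ 4 * (\<theta> ^ (2 * 2) * exp (- (a * \<theta>\<^sup>2))))
      has_integral (S * (fact (2 * 0) / ((4 * a) ^ 0 * fact 0))
        - 16 / t ^ 4 * (S * (fact (2 * 2) / ((4 * a) ^ 2 * fact 2))))) UNIV"
    by (intro has_integral_diff has_integral_mult_right moment)
  moreover have "16 / t ^ 4 * (S * (fact (2 * 2) / ((4 * a) ^ 2 * fact 2))) = S * (432 / pi ^ 4 * t\<^sup>2)"
    using t_pos by (simp add: a_def fact_numeral field_simps eval_nat_numeral)
  ultimately have "((\<lambda>\<theta>. exp (- (a * \<theta>\<^sup>2)) * (1 - 16 / t ^ 4 * \<theta> ^ 4)) has_integral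
      (S * (1 - 432 / pi ^ 4 * t\<^sup>2))) UNIV"
    by (simp add: algebra_simps)
  then show ?thesis
    by (simp only: main_term_def lower_gaussian_def a_def S_def)
qed

lemma main_term_ge: "1367 / 1000 * width \<le> main_term"
proof -
  have "138 / 100 \<le> sqrt (6 / pi)"
    using pi_approx by (intro real_le_rsqrt) (auto simp: field_simps power2_eq_square)
  moreover have "432 / pi ^ 4 * t\<^sup>2 \<le> 93 / 10000"
  proof -
    have "96 \<le> pi ^ 4" using power_mono[of "314 / 100" pi 4] pi_approx by (simp add: power_divide)
    then have "432 / pi ^ 4 \<le> 432 / 96" by (intro divide_left_mono) auto
    then have "432 / pi ^ 4 * t\<^sup>2 \<le> 432 / 96 * (1 / 22)\<^sup>2"
      using t_pos t_le by (intro mult_mono power_mono) auto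
    also have "\<dots> \<le> 93 / 10000" by (simp add: power2_eq_square)
    finally show ?thesis .
  qed
  ultimately have "138 / 100 * width * (9907 / 10000) \<le> main_term"
    unfolding main_term_def using width_pos by (intro mult_mono mult_right_mono) auto
  then show ?thesis using width_pos by linarith
qed

lemma phase_error_le: "phase_constant * gaussian_moment 3 \<le> 518 / 1000 * width"
proof -
  have "gaussian_moment 3 = 240 / pi ^ 3 * t ^ 9 * width"
    by (simp add: gaussian_moment_def width_square fact_numeral power_divide flip: power_mult)
  then have "phase_constant * gaussian_moment 3 = 150000 / 41472 * (pi * t) * width"
    using t_pos by (simp add: phase_constant_def field_simps eval_nat_numeral)
  also have "\<dots> \<le> 150000 / 41472 * (315 / 100 * (1 / 22)) * width"
    using t_pos t_le pi_approx width_pos by (intro mult_right_mono mult_left_mono mult_mono) auto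
  also have "\<dots> \<le> 518 / 1000 * width" using width_pos by (intro mult_right_mono) auto
  finally show ?thesis .
qed

lemma integral_exp_decay_cos_phase_ge:
  assumes "((\<lambda>\<theta>. exp (- decay t \<theta>) * cos (phase t \<theta>)) has_integral P) {-pi..pi}"
  shows "72 / 100 * width \<le> P"
proof -
  let ?main = "\<lambda>\<theta>. lower_gaussian \<theta> * (1 - 16 / t ^ 4 * \<theta> ^ 4)"
  let ?error = "\<lambda>\<theta>. phase_constant * (\<theta> ^ (2 * 3) * upper_gaussian \<theta>)"
  let ?arc = "\<lambda>\<theta>. if \<theta> \<in> {-pi..pi} then \<theta> ^ (2 * 0) * arc_bound \<theta> else 0"
  have arc: "(?arc has_integral arc_moment 0) UNIV"
    by (intro has_integral_restrict_UNIV[THEN iffD2] has_integral_arc_bound)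
  have "main_term - phase_constant * gaussian_moment 3 - arc_moment 0 \<le> P"
  proof (rule has_integral_le[OF _ has_integral_restrict_UNIV[THEN iffD2, OF assms]])
    show "((\<lambda>\<theta>. ?main \<theta> - ?error \<theta> - ?arc \<theta>) has_integral
        (main_term - phase_constant * gaussian_moment 3 - arc_moment 0)) UNIV"
      by (intro has_integral_diff has_integral_main_term has_integral_mult_right has_integral_gaussian arc)
    fix \<theta> :: real
    show "?main \<theta> - ?error \<theta> - ?arc \<theta>
       \<le> (if \<theta> \<in> {-pi..pi} then exp (- decay t \<theta>) * cos (phase t \<theta>) else 0)"
    proof (cases "\<bar>\<theta>\<bar> \<le> pi")
      case True
      then show ?thesis
        using exp_decay_cos_phase_ge[of \<theta>] by (auto simp: mult.assoc)
    next
      case False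
      then have "?main \<theta> \<le> 0"
        using one_le_sixteen_quartic[of \<theta>] t_less_pi t_pos
        by (intro mult_nonneg_nonpos) (auto simp: lower_gaussian_def)
      moreover have "0 \<le> ?error \<theta>"
        using t_pos by (simp add: phase_constant_def upper_gaussian_def)
      ultimately have "?main \<theta> - ?error \<theta> \<le> 0" by linarith
      moreover have "\<theta> \<notin> {-pi..pi}" using False by auto
      ultimately show ?thesis by (simp only: if_False diff_zero)
    qed
  qed
  then show ?thesis using main_term_ge phase_error_le arc_moment_0_le width_pos by linarith
qed

end

section \<open>Comparison of adjacent coefficients\<close>

lemma first_log_moment_ge:
  fixes x :: real
  assumes "0 \<le> x" "x < 1"
  shows "x / (1 - x) \<le> (\<Sum>N. real N * log_coeff N * x ^ N)"
proof -
  have "summable (\<lambda>N. real N * log_coeff N * x ^ N)"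
    using summable_norm_cancel[OF summable_norm_log_coeff[of x 1]] assms by simp
  then have series: "(\<lambda>N. real (Suc N) * log_coeff (Suc N) * x ^ Suc N)
      sums (\<Sum>N. real N * log_coeff N * x ^ N)"
    by (subst sums_Suc_iff) (simp add: summable_sums)
  have geometric: "(\<lambda>N. x * x ^ N) sums (x * (1 / (1 - x)))"
    using assms by (intro sums_mult geometric_sums) simp
  have "x * x ^ N \<le> real (Suc N) * log_coeff (Suc N) * x ^ Suc N" for N
  proof -
    have "1 * 1 \<le> real (Suc N) * log_coeff (Suc N)"
      using log_coeff_ge_1[of "Suc N"] by (intro mult_mono) auto
    then have "1 * x ^ Suc N \<le> real (Suc N) * log_coeff (Suc N) * x ^ Suc N"
      using assms by (intro mult_right_mono) auto
    then show ?thesis by simp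
  qed
  then have "x * (1 / (1 - x)) \<le> (\<Sum>N. real N * log_coeff N * x ^ N)"
    using geometric series by (rule sums_le)
  then show ?thesis by simp
qed

lemma saddle_point_exists:
  assumes "0 < n"
  obtains t :: real where "0 < t" "log_moment 1 t = real n"
proof -
  define f where "f x = (\<Sum>N. real N * log_coeff N * x ^ N)" for x :: real
  define r where "r = real n / (real n + 1)"
  have r_props: "0 < r" "r < 1" "r / (1 - r) = real n"
    using assms by (auto simp: r_def field_simps)
  have "isCont f x" if "x \<in> {0..r}" for x
  proof -
    have "summable (\<lambda>N. real N * log_coeff N * ((1 + r) / 2) ^ N)"
      using summable_norm_cancel[OF summable_norm_log_coeff[of "(1 + r) / 2" 1]] r_props by simp
    then show ?thesis
      unfolding f_def by (rule isCont_powser) (use that r_props in auto)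
  qed
  then have "continuous_on {0..r} f"
    by (intro continuous_at_imp_continuous_on) auto
  moreover have f_0: "f 0 = 0"
    using powser_zero[of "\<lambda>N. real N * log_coeff N"] by (simp add: f_def)
  moreover have "real n \<le> f r"
    using first_log_moment_ge[of r] r_props by (simp add: f_def)
  ultimately obtain x where x_root: "0 \<le> x" "x \<le> r" "f x = real n"
    using IVT'[of f 0 "real n" r] r_props by auto
  have "x \<noteq> 0" using f_0 x_root(3) assms by auto
  then have "0 < x" "x < 1" using x_root r_props by auto
  then have "0 < - ln x" "exp (- (- ln x)) = x" by auto
  then show thesis using that[of "- ln x"] x_root(3) by (simp add: f_def log_moment_def)
qed

definition kernel :: "real \<Rightarrow> real \<Rightarrow> complex" where
  "kernel t \<theta> = of_real (exp (- decay t \<theta>)) * cis (phase t \<theta>)"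

definition scaled_partition_number :: "real \<Rightarrow> nat \<Rightarrow> real" where
  "scaled_partition_number t m
     = 2 * pi * partition_number m * exp (- t) ^ m / (\<Sum>k. partition_number k * exp (- t) ^ k)"

lemma norm_kernel: "norm (kernel t \<theta>) = exp (- decay t \<theta>)"
  by (simp add: kernel_def norm_mult)

context
  fixes t :: real
  assumes t: "0 < t"
begin

lemma summable_partition_gf: "summable (\<lambda>k. partition_number k * exp (- t) ^ k)"
proof -
  have "summable (\<lambda>k. of_nat (partition_number k) * complex_of_real (exp (- t)) ^ k)"
    using partition_gf_sums[of "of_real (exp (- t))"] t by (auto simp: sums_iff)
  then have "summable (\<lambda>k. Re (of_nat (partition_number k) * complex_of_real (exp (- t)) ^ k))"
    by (rule summable_Re)
  then show ?thesis by (simp flip: of_real_power)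
qed

lemma exp_log_gf_exp:
  "exp (log_gf (of_real (exp (- t)))) = of_real (\<Sum>k. partition_number k * exp (- t) ^ k)"
proof -
  have "(\<lambda>k. complex_of_real (partition_number k * exp (- t) ^ k))
      sums of_real (\<Sum>k. partition_number k * exp (- t) ^ k)"
    using summable_partition_gf by (intro sums_of_real summable_sums)
  moreover have "(\<lambda>k. complex_of_real (partition_number k * exp (- t) ^ k))
      sums exp (log_gf (of_real (exp (- t))))"
    using partition_gf_sums[of "of_real (exp (- t))"] t by simp
  ultimately show ?thesis by (rule sums_unique2[symmetric])
qed

lemma continuous_on_exp_decay: "continuous_on A (\<lambda>\<theta>. exp (- decay t \<theta>))"
proof -
  have "decay t \<theta> = Re (log_gf (of_real (exp (- t)))) - Re (log_gf (of_real (exp (- t)) * cis \<theta>))" for \<theta>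
    using log_gf_circle[OF t, of \<theta>] by simp
  moreover have "continuous_on A (\<lambda>\<theta>. log_gf (of_real (exp (- t)) * cis \<theta>))"
    by (rule continuous_on_compose2[OF holomorphic_on_imp_continuous_on[OF holomorphic_on_log_gf]])
       (use t in \<open>auto intro!: continuous_intros simp: norm_mult\<close>)
  ultimately show ?thesis by (auto intro!: continuous_intros)
qed

lemma has_integral_kernel:
  assumes "log_moment 1 t = real n"
  shows "((\<lambda>\<theta>. kernel t \<theta> * cis ((real n - real m) * \<theta>)) has_integral
           of_real (scaled_partition_number t m)) {-pi..pi}"
proof -
  define x where "x = exp (- t)"
  define F where "F = (\<Sum>k. partition_number k * x ^ k)"
  have x_bounds: "0 < x" "x < 1" using t by (auto simp: x_def)
  have F_eq: "exp (log_gf (of_real x)) = of_real F"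
    using exp_log_gf_exp by (simp add: F_def x_def)
  then have F_nz: "complex_of_real F \<noteq> 0" by (metis exp_not_eq_zero)
  have "exp (log_gf (of_real x * cis \<theta>)) = F * kernel t \<theta> * cis (real n * \<theta>)" for \<theta>
  proof -
    have "log_gf (of_real x * cis \<theta>)
        = log_gf (of_real x) + \<i> * of_real (real n * \<theta>) + Complex (- decay t \<theta>) (phase t \<theta>)"
      using log_gf_circle[OF t, of \<theta>] unfolding x_def assms by (simp add: mult.commute)
    moreover have "exp (Complex (- decay t \<theta>) (phase t \<theta>)) = kernel t \<theta>"
      by (subst exp_eq_polar) (simp add: kernel_def)
    ultimately show ?thesis by (simp add: exp_add F_eq cis_conv_exp mult_ac)
  qed
  then have polar: "exp (log_gf (of_real x * cis \<theta>)) * cis (- (of_nat m * \<theta>)) / F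
      = kernel t \<theta> * cis ((real n - real m) * \<theta>)" for \<theta>
    using F_nz by (simp add: cis_mult algebra_simps)
  have "((\<lambda>\<theta>. exp (log_gf (of_real x * cis \<theta>)) * cis (- (of_nat m * \<theta>))) has_integral
      (complex_of_real (2 * pi) * of_nat (partition_number m) * of_real x ^ m)) {-pi..pi}"
  proof (rule has_integral_fourier_coefficient)
    show "summable (\<lambda>k. norm (of_nat (partition_number k) :: complex) * x ^ k)"
      using summable_partition_gf by (simp add: x_def)
    show "(\<lambda>k. of_nat (partition_number k) * (of_real x * cis \<theta>) ^ k)
        sums exp (log_gf (of_real x * cis \<theta>))" for \<theta>
      using x_bounds by (intro partition_gf_sums) (simp add: norm_mult)
  qed (use x_bounds in simp)
  then have "((\<lambda>\<theta>. exp (log_gf (of_real x * cis \<theta>)) * cis (- (of_nat m * \<theta>)) / F) has_integral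
      complex_of_real (2 * pi) * of_nat (partition_number m) * of_real x ^ m / F) {-pi..pi}"
    by (rule has_integral_divide)
  then show ?thesis
    unfolding polar by (simp add: scaled_partition_number_def F_def x_def)
qed

end

lemma abs_central_minus_mean_le:
  fixes H :: "real \<Rightarrow> complex" and P0 P1 Pm J :: real
  assumes P0_integral: "(H has_integral of_real P0) {a..b}"
    and P1_integral: "((\<lambda>\<theta>. H \<theta> * cis (- \<theta>)) has_integral of_real P1) {a..b}"
    and Pm_integral: "((\<lambda>\<theta>. H \<theta> * cis \<theta>) has_integral of_real Pm) {a..b}"
    and J_integral: "((\<lambda>\<theta>. norm (H \<theta>) * (1 - cos \<theta>)) has_integral J) {a..b}"
  shows "\<bar>P0 - (P1 + Pm) / 2\<bar> \<le> J"
proof -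
  have "((\<lambda>\<theta>. H \<theta> - (H \<theta> * cis (- \<theta>) + H \<theta> * cis \<theta>) * (1 / 2)) has_integral
      (of_real P0 - (of_real P1 + of_real Pm) * (1 / 2))) {a..b}"
    by (intro has_integral_diff has_integral_mult_left has_integral_add
          P0_integral P1_integral Pm_integral)
  moreover have "H \<theta> - (H \<theta> * cis (- \<theta>) + H \<theta> * cis \<theta>) * (1 / 2) = H \<theta> * of_real (1 - cos \<theta>)" for \<theta>
    by (simp add: complex_eq_iff field_simps)
  ultimately have "((\<lambda>\<theta>. H \<theta> * of_real (1 - cos \<theta>)) has_integral of_real (P0 - (P1 + Pm) / 2)) {a..b}"
    by simp
  from has_integral_norm_bound_integral_component[OF this J_integral, of 1] show ?thesis
    by (simp add: norm_mult del: of_real_diff of_real_add of_real_divide)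
qed

lemma abs_sin_le:
  fixes \<epsilon> \<theta> :: real
  assumes "0 < \<epsilon>"
  shows "\<bar>sin \<theta>\<bar> \<le> \<epsilon> / 2 + (1 - cos \<theta>) / \<epsilon>"
proof -
  have "2 * \<epsilon> * \<bar>sin \<theta>\<bar> \<le> \<epsilon>\<^sup>2 + \<bar>sin \<theta>\<bar>\<^sup>2"
    using zero_le_power2[of "\<epsilon> - \<bar>sin \<theta>\<bar>"] by (simp add: power2_eq_square algebra_simps)
  also have "\<bar>sin \<theta>\<bar>\<^sup>2 = (1 - cos \<theta>) * (1 + cos \<theta>)"
    using sin_squared_eq[of \<theta>] by (simp add: power2_eq_square algebra_simps)
  also have "\<dots> \<le> (1 - cos \<theta>) * 2" by (intro mult_left_mono) auto
  finally show ?thesis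
    using assms by (simp add: field_simps power2_eq_square)
qed

lemma abs_half_difference_le:
  fixes H :: "real \<Rightarrow> complex" and P1 Pm I J \<epsilon> :: real
  assumes P1_integral: "((\<lambda>\<theta>. H \<theta> * cis (- \<theta>)) has_integral of_real P1) {a..b}"
    and Pm_integral: "((\<lambda>\<theta>. H \<theta> * cis \<theta>) has_integral of_real Pm) {a..b}"
    and I_integral: "((\<lambda>\<theta>. norm (H \<theta>)) has_integral I) {a..b}"
    and J_integral: "((\<lambda>\<theta>. norm (H \<theta>) * (1 - cos \<theta>)) has_integral J) {a..b}"
    and \<epsilon>_pos: "0 < \<epsilon>"
  shows "\<bar>(P1 - Pm) / 2\<bar> \<le> \<epsilon> / 2 * I + J / \<epsilon>"
proof -
  have "((\<lambda>\<theta>. (H \<theta> * cis (- \<theta>) - H \<theta> * cis \<theta>) * (1 / 2)) has_integral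
      ((of_real P1 - of_real Pm) * (1 / 2))) {a..b}"
    by (intro has_integral_diff has_integral_mult_left P1_integral Pm_integral)
  moreover have "(H \<theta> * cis (- \<theta>) - H \<theta> * cis \<theta>) * (1 / 2) = H \<theta> * (- \<i> * of_real (sin \<theta>))" for \<theta>
    by (simp add: complex_eq_iff field_simps)
  ultimately have sine: "((\<lambda>\<theta>. H \<theta> * (- \<i> * of_real (sin \<theta>))) has_integral
      of_real ((P1 - Pm) / 2)) {a..b}"
    by simp
  have majorant: "((\<lambda>\<theta>. \<epsilon> / 2 * norm (H \<theta>) + norm (H \<theta>) * (1 - cos \<theta>) / \<epsilon>) has_integral
      (\<epsilon> / 2 * I + J / \<epsilon>)) {a..b}"
    using has_integral_mult_right[OF I_integral] has_integral_divide[OF J_integral]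
    by (rule has_integral_add)
  have "norm (H \<theta> * (- \<i> * of_real (sin \<theta>)))
      \<le> \<epsilon> / 2 * norm (H \<theta>) + norm (H \<theta>) * (1 - cos \<theta>) / \<epsilon>" for \<theta>
    using mult_left_mono[OF abs_sin_le[OF \<epsilon>_pos, of \<theta>], of "norm (H \<theta>)"]
    by (simp add: norm_mult algebra_simps)
  then have "norm (complex_of_real ((P1 - Pm) / 2)) \<le> (\<epsilon> / 2 * I + J / \<epsilon>) \<bullet> 1"
    by (intro has_integral_norm_bound_integral_component[OF sine majorant]) simp
  then show ?thesis
    by (simp only: norm_of_real inner_real_def mult_1_right)
qed

lemma product_of_neighbours_ge:
  fixes P0 P1 Pm J K :: real
  assumes "0 \<le> P0" "0 \<le> J" and mean: "\<bar>P0 - (P1 + Pm) / 2\<bar> \<le> J"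
    and difference: "\<bar>(P1 - Pm) / 2\<bar> \<le> K"
  shows "P0\<^sup>2 - (2 * P0 * J + K\<^sup>2) \<le> P1 * Pm"
proof -
  define b c where "b = (P1 + Pm) / 2" and "c = (P1 - Pm) / 2"
  have "P0\<^sup>2 - 2 * P0 * J \<le> b\<^sup>2"
  proof (cases "P0 \<le> J")
    case True
    then have "P0 * P0 \<le> P0 * (2 * J)" using assms by (intro mult_left_mono) auto
    then have "P0\<^sup>2 - 2 * P0 * J \<le> 0" by (simp add: power2_eq_square algebra_simps)
    then show ?thesis using zero_le_power2[of b] by linarith
  next
    case False
    have "P0 - J \<le> b" using mean unfolding b_def by linarith
    then have "(P0 - J)\<^sup>2 \<le> b\<^sup>2" using False by (intro power_mono) auto
    moreover have "(P0 - J)\<^sup>2 = P0\<^sup>2 - 2 * P0 * J + J\<^sup>2"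
      by (simp add: power2_eq_square algebra_simps)
    ultimately show ?thesis using zero_le_power2[of J] by linarith
  qed
  moreover have "c\<^sup>2 \<le> K\<^sup>2"
    using difference unfolding c_def by (rule abs_le_square_iff[THEN iffD1, OF order_trans]) simp
  moreover have "P1 * Pm = b\<^sup>2 - c\<^sup>2"
    by (simp add: b_def c_def power2_eq_square field_simps)
  ultimately show ?thesis by linarith
qed

text \<open>The constants are those of the integral estimates for \<open>t \<le> 1/22\<close>. Little room is left, which is
  what determines the threshold \<open>n \<ge> 800\<close>.\<close>
lemma relative_error_less:
  fixes P0 J K v M :: real
  assumes v_pos: "0 < v" and M_bounds: "0 < M" "M * v\<^sup>2 \<le> 3 / 40"
    and P0_ge: "72 / 100 * v \<le> P0" and J_le: "J \<le> 118 / 100 * v ^ 3"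
    and K_bounds: "0 \<le> K" "K \<le> 2245 / 1000 * v\<^sup>2"
  shows "M * (2 * P0 * J + K\<^sup>2) < P0\<^sup>2"
proof -
  have P0_pos: "0 < P0" using P0_ge v_pos by linarith
  have "M * (2 * P0 * J + K\<^sup>2) \<le> M * (2 * P0 * (118 / 100 * v ^ 3) + (2245 / 1000 * v\<^sup>2)\<^sup>2)"
    using M_bounds P0_pos J_le K_bounds by (intro mult_left_mono add_mono power_mono) auto
  also have "\<dots> = (236 / 100 * P0 * v + (2245 / 1000)\<^sup>2 * v\<^sup>2) * (M * v\<^sup>2)"
    by (simp add: power2_eq_square power3_eq_cube algebra_simps)
  also have "\<dots> \<le> (236 / 100 * P0 * v + (2245 / 1000)\<^sup>2 * v\<^sup>2) * (3 / 40)"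
    using M_bounds P0_pos v_pos by (intro mult_left_mono) auto
  also have "\<dots> \<le> 177 / 1000 * (P0 * v) + 379 / 1000 * v\<^sup>2"
    by (simp add: power2_eq_square)
  also have "\<dots> < P0\<^sup>2"
  proof -
    have "(72 / 100 * v) * (543 / 1000 * v) \<le> P0 * (P0 - 177 / 1000 * v)"
      using P0_ge v_pos P0_pos by (intro mult_mono) auto
    moreover have "379 / 1000 * v\<^sup>2 < (72 / 100 * v) * (543 / 1000 * v)"
      using v_pos by (simp add: power2_eq_square)
    ultimately show ?thesis by (simp add: power2_eq_square algebra_simps)
  qed
  finally show ?thesis .
qed

lemma saddle_point_bounds:
  assumes t_saddle: "0 < t" "log_moment 1 t = real n" and n_ge: "800 \<le> n"
  shows "t \<le> 1 / 22" and "(real n + 1) * t ^ 3 \<le> 3 / 40"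
proof -
  have "real n \<le> pi\<^sup>2 / 6 / t\<^sup>2" using log_moment_bounds(1)[OF t_saddle(1)] t_saddle(2) by simp
  then have "real n * t\<^sup>2 \<le> pi\<^sup>2 / 6" using t_saddle by (simp add: field_simps)
  also have "\<dots> \<le> (3142 / 1000)\<^sup>2 / 6"
    using pi_approx by (intro divide_right_mono power_mono) auto
  finally have nt_le: "real n * t\<^sup>2 \<le> 1646 / 1000" by (simp add: power2_eq_square)
  show t_le: "t \<le> 1 / 22"
  proof (rule power2_le_imp_le)
    have "800 * t\<^sup>2 \<le> real n * t\<^sup>2" using n_ge by (intro mult_right_mono) auto
    then show "t\<^sup>2 \<le> (1 / 22)\<^sup>2" using nt_le by (simp add: power2_eq_square)
  qed simp
  have "(real n + 1) * t ^ 3 = (real n * t\<^sup>2 + t\<^sup>2) * t"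
    by (simp add: power2_eq_square power3_eq_cube algebra_simps)
  also have "\<dots> \<le> (1646 / 1000 + (1 / 22)\<^sup>2) * (1 / 22)"
    using nt_le t_saddle t_le by (intro mult_mono add_mono power_mono) auto
  finally show "(real n + 1) * t ^ 3 \<le> 3 / 40" by (simp add: power2_eq_square)
qed

context small_saddle
begin

lemma half_difference_bound:
  assumes "((\<lambda>\<theta>. exp (- decay t \<theta>)) has_integral I) {-pi..pi}"
    and "((\<lambda>\<theta>. exp (- decay t \<theta>) * (1 - cos \<theta>)) has_integral J) {-pi..pi}"
  shows "width / 2 * I + J / width \<le> 2245 / 1000 * width\<^sup>2"
proof -
  have "width / 2 * I \<le> width / 2 * (213 / 100 * width)"
    using integral_exp_decay_le[OF assms(1)] width_pos by (intro mult_left_mono) auto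
  moreover have "J / width \<le> 118 / 100 * width ^ 3 / width"
    using integral_exp_decay_cos_le[OF assms(2)] width_pos by (intro divide_right_mono) auto
  moreover have "118 / 100 * width ^ 3 / width = 118 / 100 * width\<^sup>2"
    using width_pos by (simp add: power2_eq_square power3_eq_cube)
  ultimately show ?thesis by (simp add: power2_eq_square)
qed

end

locale saddle_point = small_saddle +
  fixes n :: nat
  assumes n_pos: "0 < n" and saddle: "log_moment 1 t = real n"
begin

abbreviation coefficient :: "nat \<Rightarrow> real" where
  "coefficient \<equiv> scaled_partition_number t"

lemma has_integral_kernel_central: "(kernel t has_integral of_real (coefficient n)) {-pi..pi}"
  using has_integral_kernel[OF t_pos saddle, of n] by simp

lemma has_integral_kernel_next:
  "((\<lambda>\<theta>. kernel t \<theta> * cis (- \<theta>)) has_integral of_real (coefficient (n + 1))) {-pi..pi}"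
  using has_integral_kernel[OF t_pos saddle, of "n + 1"] by simp

lemma has_integral_kernel_previous:
  "((\<lambda>\<theta>. kernel t \<theta> * cis \<theta>) has_integral of_real (coefficient (n - 1))) {-pi..pi}"
  using has_integral_kernel[OF t_pos saddle, of "n - 1"] n_pos by (simp add: of_nat_diff)

lemma coefficient_ge: "72 / 100 * width \<le> coefficient n"
proof (rule integral_exp_decay_cos_phase_ge)
  show "((\<lambda>\<theta>. exp (- decay t \<theta>) * cos (phase t \<theta>)) has_integral coefficient n) {-pi..pi}"
    using has_integral_linear[OF has_integral_kernel_central bounded_linear_Re]
    by (simp add: o_def kernel_def)
qed

lemma coefficient_nearly_log_concave:
  assumes "(real n + 1) * t ^ 3 \<le> 3 / 40"
  shows "real n * (coefficient n)\<^sup>2 < (real n + 1) * (coefficient (n + 1) * coefficient (n - 1))"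
proof -
  obtain I where I_integral: "((\<lambda>\<theta>. exp (- decay t \<theta>)) has_integral I) {-pi..pi}"
    using integrable_continuous_real[OF continuous_on_exp_decay[OF t_pos]] by blast
  have "continuous_on {-pi..pi} (\<lambda>\<theta>. exp (- decay t \<theta>) * (1 - cos \<theta>))"
    by (intro continuous_on_mult continuous_on_exp_decay t_pos continuous_intros)
  then obtain J where J_integral: "((\<lambda>\<theta>. exp (- decay t \<theta>) * (1 - cos \<theta>)) has_integral J) {-pi..pi}"
    using integrable_continuous_real by blast
  define K where "K = width / 2 * I + J / width"
  have half_difference: "\<bar>(coefficient (n + 1) - coefficient (n - 1)) / 2\<bar> \<le> K"
    unfolding K_def using has_integral_kernel_next has_integral_kernel_previous
    by (rule abs_half_difference_le) (simp_all add: norm_kernel I_integral J_integral width_pos)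
  have "(coefficient n)\<^sup>2 - (2 * coefficient n * J + K\<^sup>2) \<le> coefficient (n + 1) * coefficient (n - 1)"
  proof (rule product_of_neighbours_ge[OF _ _ _ half_difference])
    show "0 \<le> coefficient n" using coefficient_ge width_pos by linarith
    show "0 \<le> J" using J_integral by (rule has_integral_nonneg) simp
    show "\<bar>coefficient n - (coefficient (n + 1) + coefficient (n - 1)) / 2\<bar> \<le> J"
      using has_integral_kernel_central has_integral_kernel_next has_integral_kernel_previous
      by (rule abs_central_minus_mean_le) (simp add: norm_kernel J_integral)
  qed
  then have "(real n + 1) * ((coefficient n)\<^sup>2 - (2 * coefficient n * J + K\<^sup>2))
      \<le> (real n + 1) * (coefficient (n + 1) * coefficient (n - 1))"
    by (intro mult_left_mono) auto
  moreover have "(real n + 1) * (2 * coefficient n * J + K\<^sup>2) < (coefficient n)\<^sup>2"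
    using width_pos _ _ coefficient_ge integral_exp_decay_cos_le[OF J_integral]
  proof (rule relative_error_less)
    show "0 \<le> K" using half_difference by linarith
    show "K \<le> 2245 / 1000 * width\<^sup>2"
      unfolding K_def using I_integral J_integral by (rule half_difference_bound)
  qed (use assms in \<open>simp_all add: width_square\<close>)
  ultimately show ?thesis by (simp add: algebra_simps)
qed

end

lemma scaled_partition_number_mult:
  assumes "0 < t"
  obtains D where "0 < D"
    "\<And>m n. scaled_partition_number t m * scaled_partition_number t n
       = D * exp (- t) ^ (m + n) * real (partition_number m * partition_number n)"
proof -
  define D where "D = (2 * pi / (\<Sum>k. partition_number k * exp (- t) ^ k))\<^sup>2"
  have "(\<Sum>k. partition_number k * exp (- t) ^ k) \<noteq> 0"
    using exp_log_gf_exp[OF assms] by (metis exp_not_eq_zero of_real_0)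
  then have "0 < D" by (simp add: D_def)
  then show thesis
    by (rule that) (simp add: D_def scaled_partition_number_def power2_eq_square power_add)
qed

lemma nearly_log_concave_at_large:
  assumes "800 \<le> n"
  shows "nearly_log_concave_at n"
proof -
  obtain t where t_saddle: "0 < t" "log_moment 1 t = real n"
    using saddle_point_exists[of n] assms by auto
  interpret saddle_point t n
    using t_saddle saddle_point_bounds(1)[OF t_saddle assms] assms by unfold_locales auto
  obtain D where D_pos: "0 < D" and product: "\<And>m n. coefficient m * coefficient n
       = D * exp (- t) ^ (m + n) * real (partition_number m * partition_number n)"
    using scaled_partition_number_mult[OF t_saddle(1)] by blast
  define E where "E = D * exp (- t) ^ (n + n)"
  have "real n * (coefficient n)\<^sup>2 < (real n + 1) * (coefficient (n + 1) * coefficient (n - 1))"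
    using saddle_point_bounds(2)[OF t_saddle assms] by (rule coefficient_nearly_log_concave)
  moreover have "n + 1 + (n - 1) = n + n" using assms by simp
  ultimately have "E * (real n * (real (partition_number n))\<^sup>2)
      < E * ((real n + 1) * real (partition_number (n - 1) * partition_number (n + 1)))"
    unfolding power2_eq_square product E_def by (simp add: mult_ac)
  moreover have "0 < E" using D_pos by (simp add: E_def)
  ultimately have "real n * (real (partition_number n))\<^sup>2
      < (real n + 1) * real (partition_number (n - 1) * partition_number (n + 1))"
    by (simp only: mult_less_cancel_left_pos)
  then have "real (n * (partition_number n)\<^sup>2)
      < real ((n + 1) * (partition_number (n - 1) * partition_number (n + 1)))"
    by (simp add: algebra_simps)
  then show ?thesis
    unfolding nearly_log_concave_at_def by (simp only: of_nat_less_iff)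
qed

theorem theorem4p1:
  fixes n :: nat
  assumes "n > 1"
  shows "real (partition_number (n - 1)) / real (partition_number n) * (1 + 1 / real n)
           > real (partition_number n) / real (partition_number (n + 1))"
proof -
  define a b c where "a = real (partition_number (n - 1))" and "b = real (partition_number n)"
    and "c = real (partition_number (n + 1))"
  have pos: "0 < a" "0 < b" "0 < c" "0 < real n"
    using partition_number_pos assms by (auto simp: a_def b_def c_def)
  have "nearly_log_concave_at n"
    using assms nearly_log_concave_at_small nearly_log_concave_at_large
    by (cases "n < 800") auto
  then have "real (n * (partition_number n)\<^sup>2)
      < real ((n + 1) * (partition_number (n - 1) * partition_number (n + 1)))"
    unfolding nearly_log_concave_at_def by (simp only: of_nat_less_iff)
  then have "real n * (b * b) < (real n + 1) * (a * c)"
    by (simp add: a_def b_def c_def power2_eq_square algebra_simps)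
  then have "b / c < a / b * (1 + 1 / real n)"
    using pos by (simp add: field_simps)
  then show ?thesis unfolding a_def b_def c_def .
qed

end
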